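(* Let $n\geq 16$ and let $G=G(X,Y)$ be a balanced bipartite graph with parts $X$ and $Y$, $|X|=|Y|=n$ (so $G$ has order $2n$), such that $G$ is 1-tough in the bipartite sense, i.e. $t^{B}(G)\geq 1$. If $\rho(G)\geq\rho(G_{n,n})$, then $G$ contains a Hamilton cycle, unless $G\cong G_{n,n}$.
   Context: All graphs are finite, simple and undirected. The spectral radius $\rho(G)$ of a graph $G$ is the largest eigenvalue of its adjacency matrix. For a graph $G$ and $S\subseteq V(G)$, $G-S$ is obtained by deleting $S$ and all incident edges, and $c(G-S)$ denotes the number of connected components of $G-S$. For a non-complete bipartite graph $G$ with parts $X$ and $Y$, the bipartite toughness is $t^{B}(G)=\min\{|S|/c(G-S)\}$, where the minimum is taken over all proper subsets $S\subset X$ or $S\subset Y$ with $c(G-S)>1$; $G$ is called 1-tough if $t^{B}(G)\geq 1$, i.e. $|S|\geq c(G-S)$ for every proper subset $S$ of $X$ or of $Y$ with $c(G-S)>1$. The graph $G_{n,n}$ is defined as follows: take the complete bipartite graph $K_{n,n-3}$ with parts $\{u_1,\dots,u_n\}$ and $\{v_4,\dots,v_n\}$, add three new vertices $v_1,v_2,v_3$, join each of $v_1,v_2,v_3$ to $u_1$, and join $v_i$ to $u_{i+1}$ for each $1\leq i\leq 3$. Thus $G_{n,n}$ is a balanced bipartite graph with parts $\{u_1,\dots,u_n\}$ and $\{v_1,\dots,v_n\}$. *)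

theory Defs
  imports Complex_Main
begin

definition simple_graph :: "'a set \<Rightarrow> 'a set set \<Rightarrow> bool" where
  "simple_graph V E \<longleftrightarrow> finite V \<and>
     (\<forall>e\<in>E. \<exists>u v. e = {u, v} \<and> u \<noteq> v \<and> u \<in> V \<and> v \<in> V)"

definition bipartite_graph :: "'a set \<Rightarrow> 'a set \<Rightarrow> 'a set set \<Rightarrow> bool" where
  "bipartite_graph X Y E \<longleftrightarrow> simple_graph (X \<union> Y) E \<and> X \<inter> Y = {} \<and>
     (\<forall>e\<in>E. \<exists>x\<in>X. \<exists>y\<in>Y. e = {x, y})"

text \<open>Adjacency matrix entries, eigenvalues and spectral radius (largest eigenvalue).
  The adjacency matrix is real symmetric, so all eigenvalues are real.\<close>

definition adj :: "'a set set \<Rightarrow> 'a \<Rightarrow> 'a \<Rightarrow> real" where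
  "adj E u v = (if {u, v} \<in> E then 1 else 0)"

definition adj_eigenvalues :: "'a set \<Rightarrow> 'a set set \<Rightarrow> real set" where
  "adj_eigenvalues V E = {mu. \<exists>x :: 'a \<Rightarrow> real.
      (\<exists>v\<in>V. x v \<noteq> 0) \<and>
      (\<forall>v\<in>V. (\<Sum>u\<in>V. adj E v u * x u) = mu * x v)}"

definition spectral_radius :: "'a set \<Rightarrow> 'a set set \<Rightarrow> real" where
  "spectral_radius V E = Max (adj_eigenvalues V E)"

definition reach :: "'a set \<Rightarrow> 'a set set \<Rightarrow> 'a \<Rightarrow> 'a \<Rightarrow> bool" where
  "reach W E = (\<lambda>a b. a \<in> W \<and> b \<in> W \<and> {a, b} \<in> E)\<^sup>*\<^sup>*"

definition num_components :: "'a set \<Rightarrow> 'a set set \<Rightarrow> nat" where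
  "num_components W E = card {C. \<exists>v\<in>W. C = {u\<in>W. reach W E v u}}"

definition bip_one_tough :: "'a set \<Rightarrow> 'a set \<Rightarrow> 'a set set \<Rightarrow> bool" where
  "bip_one_tough X Y E \<longleftrightarrow>
     (\<forall>S. (S \<subset> X \<or> S \<subset> Y) \<and> num_components ((X \<union> Y) - S) E > 1 \<longrightarrow>
          card S \<ge> num_components ((X \<union> Y) - S) E)"

definition hamiltonian :: "'a set \<Rightarrow> 'a set set \<Rightarrow> bool" where
  "hamiltonian V E \<longleftrightarrow> (\<exists>vs. distinct vs \<and> set vs = V \<and> length vs \<ge> 3 \<and>
     (\<forall>i < length vs. {vs ! i, vs ! ((i + 1) mod length vs)} \<in> E))"

definition graph_iso :: "'a set \<Rightarrow> 'a set set \<Rightarrow> 'b set \<Rightarrow> 'b set set \<Rightarrow> bool" where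
  "graph_iso V E V' E' \<longleftrightarrow> (\<exists>f. bij_betw f V V' \<and>
     (\<forall>u\<in>V. \<forall>v\<in>V. {u, v} \<in> E \<longleftrightarrow> {f u, f v} \<in> E'))"

definition Gnn_X :: "nat \<Rightarrow> (nat + nat) set" where
  "Gnn_X n = Inl ` {1..n}"

definition Gnn_Y :: "nat \<Rightarrow> (nat + nat) set" where
  "Gnn_Y n = Inr ` {1..n}"

definition Gnn_E :: "nat \<Rightarrow> (nat + nat) set set" where
  "Gnn_E n =
     {{Inl i, Inr j} | i j. i \<in> {1..n} \<and> j \<in> {4..n}}
   \<union> {{Inl 1, Inr j} | j. j \<in> {1, 2, 3}}
   \<union> {{Inl (i + 1), Inr i} | i. i \<in> {1, 2, 3}}"

end

theory Submission
  imports Defs "HOL-Analysis.Convex" "Jordan_Normal_Form.Char_Poly"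
begin

text \<open>
  Every eigenvalue \<open>\<mu>\<close> of a bipartite graph satisfies \<open>\<mu>\<^sup>2 \<le> e(G)\<close>, while \<open>G\<^sub>n\<^sub>,\<^sub>n\<close> has an explicit positive
  eigenvector whose eigenvalue exceeds \<open>\<rho>(K\<^sub>n\<^sub>,\<^sub>n\<^sub>-\<^sub>3)\<close>; so \<open>G\<close> has more than \<open>n(n - 3)\<close> edges.
  Let \<open>F \<supseteq> G\<close> be edge-maximal without a Hamilton cycle. By the bipartite closure argument non-adjacent
  \<open>x, y\<close> satisfy \<open>d(x) + d(y) \<le> n\<close> in \<open>F\<close>. As fewer than \<open>3n\<close> pairs are non-adjacent and \<open>n \<ge> 16\<close>,
  every degree is at most 3 or at least \<open>n - 3\<close>, at most three vertices have low degree, and all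
  other pairs are adjacent. Toughness gives \<open>|N(T)| > |T|\<close> for small one-sided \<open>T\<close>; this leaves three
  low vertices on one side, all of degree 2, whose neighbourhoods are either disjoint (then \<open>F\<close> has a
  Hamilton cycle) or share one vertex (then \<open>F\<close> is \<open>G\<^sub>n\<^sub>,\<^sub>n\<close>). Finally a proper connected spanning subgraph
  of \<open>G\<^sub>n\<^sub>,\<^sub>n\<close> has strictly smaller spectral radius, so \<open>G = F\<close>.
\<close>

section \<open>Eigenvalues of adjacency matrices\<close>

lemma adj_commute: "adj E u v = adj E v u"
  by (simp add: adj_def insert_commute)

text \<open>The scalar type stays open because two instances are needed: the real one places the
  spectrum among the roots of the characteristic polynomial, the complex one supplies a first
  eigenvalue. The bijection \<open>h\<close> numbers the vertices.\<close>

lemma matrix_eigenvalue_iff: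
  fixes k :: "'b :: {field, real_algebra_1}"
  assumes h: "bij_betw h {0..<N} V"
  shows "eigenvalue (mat N N (\<lambda>(i, j). of_real (adj E (h i) (h j)))) k \<longleftrightarrow>
    (\<exists>z. (\<exists>v\<in>V. z v \<noteq> 0) \<and> (\<forall>v\<in>V. (\<Sum>u\<in>V. of_real (adj E v u) * z u) = k * z v))"
    (is "eigenvalue ?A k \<longleftrightarrow> ?R")
proof -
  have V: "V = h ` {0..<N}" using h by (simp add: bij_betw_def)
  have re: "(\<Sum>u\<in>V. F u) = (\<Sum>j = 0..<N. F (h j))" for F :: "_ \<Rightarrow> 'b"
    using sum.reindex_bij_betw[OF h, of F] by simp
  have mv: "(?A *\<^sub>v w) $ i = (\<Sum>j = 0..<N. of_real (adj E (h i) (h j)) * w $ j)"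
    if "i < N" "w \<in> carrier_vec N" for i w
    using that by (simp add: scalar_prod_def)
  show ?thesis
  proof
    assume "eigenvalue ?A k"
    then obtain w where w: "w \<in> carrier_vec N" "w \<noteq> 0\<^sub>v N" "?A *\<^sub>v w = k \<cdot>\<^sub>v w"
      unfolding eigenvalue_def eigenvector_def by auto
    let ?z = "\<lambda>v. w $ inv_into {0..<N} h v"
    have z: "?z (h j) = w $ j" if "j < N" for j
      using that h by (simp add: bij_betw_def inv_into_f_f)
    have "\<exists>v\<in>V. ?z v \<noteq> 0"
    proof (rule ccontr)
      assume "\<not> ?thesis"
      then have "w $ j = 0" if "j < N" for j using z[OF that] that V by force
      then have "w = 0\<^sub>v N" using w(1) by (intro eq_vecI) auto
      then show False using w(2) by simp
    qed
    moreover have "(\<Sum>u\<in>V. of_real (adj E v u) * ?z u) = k * ?z v" if vV: "v \<in> V" for v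
    proof -
      obtain i where i: "i < N" "v = h i" using vV V by auto
      have "(\<Sum>u\<in>V. of_real (adj E v u) * ?z u) = (\<Sum>j = 0..<N. of_real (adj E (h i) (h j)) * w $ j)"
        unfolding re using i z by (intro sum.cong) auto
      also have "\<dots> = (?A *\<^sub>v w) $ i" by (rule mv[OF i(1) w(1), symmetric])
      also have "\<dots> = k * w $ i" unfolding w(3) using w(1) i by simp
      finally show ?thesis using z i by simp
    qed
    ultimately show ?R by (intro exI[of _ ?z]) blast
  next
    assume ?R
    then obtain z where z: "\<exists>v\<in>V. z v \<noteq> 0"
      "\<And>v. v \<in> V \<Longrightarrow> (\<Sum>u\<in>V. of_real (adj E v u) * z u) = k * z v" by blast
    let ?w = "vec N (\<lambda>i. z (h i))"
    obtain i where "i < N" "z (h i) \<noteq> 0" using z(1) V by auto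
    then have "?w $ i \<noteq> 0\<^sub>v N $ i" by simp
    then have "?w \<noteq> 0\<^sub>v N" by metis
    moreover have "?A *\<^sub>v ?w = k \<cdot>\<^sub>v ?w"
    proof (rule eq_vecI)
      fix i assume "i < dim_vec (k \<cdot>\<^sub>v ?w)"
      then have i: "i < N" by simp
      then have "h i \<in> V" using V by auto
      then show "(?A *\<^sub>v ?w) $ i = (k \<cdot>\<^sub>v ?w) $ i"
        using mv[OF i, of ?w] z(2)[of "h i"] i unfolding re by simp
    qed simp
    ultimately show "eigenvalue ?A k" unfolding eigenvalue_def eigenvector_def
      by (intro exI[of _ ?w]) simp
  qed
qed

text \<open>\<open>Max\<close> in \<open>spectral_radius\<close> is meaningful only for a finite
  non-empty set. The eigenvalues are among the roots of a monic, hence non-zero, polynomial.\<close>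

lemma finite_adj_eigenvalues:
  assumes "finite V"
  shows "finite (adj_eigenvalues V E)"
proof -
  obtain h where h: "bij_betw h {0..<card V} V" using ex_bij_betw_nat_finite[OF assms] by blast
  let ?A = "mat (card V) (card V) (\<lambda>(i, j). of_real (adj E (h i) (h j))) :: real mat"
  have A: "?A \<in> carrier_mat (card V) (card V)" by simp
  have "adj_eigenvalues V E \<subseteq> {k. poly (char_poly ?A) k = 0}"
    unfolding adj_eigenvalues_def eigenvalue_root_char_poly[OF A, symmetric] matrix_eigenvalue_iff[OF h]
    by simp
  moreover have "char_poly ?A \<noteq> 0" using degree_monic_char_poly[OF A] by auto
  ultimately show ?thesis using poly_roots_finite finite_subset by blast
qed

text \<open>The complex characteristic polynomial has a root; symmetry of the matrix makes it real,
  and the real or the imaginary part of the eigenvector, whichever is non-zero, is a real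
  eigenvector.\<close>

lemma adj_eigenvalues_nonempty:
  assumes "finite V" "V \<noteq> {}"
  shows "adj_eigenvalues V E \<noteq> {}"
proof -
  obtain h where h: "bij_betw h {0..<card V} V" using ex_bij_betw_nat_finite[OF assms(1)] by blast
  let ?A = "mat (card V) (card V) (\<lambda>(i, j). of_real (adj E (h i) (h j))) :: complex mat"
  have A: "?A \<in> carrier_mat (card V) (card V)" by simp
  have "degree (char_poly ?A) > 0"
    using degree_monic_char_poly[OF A] assms by (simp add: card_gt_0_iff)
  then obtain k where "poly (char_poly ?A) k = 0"
    using alg_closed_imp_poly_has_root[of "char_poly ?A"] by blast
  then have "eigenvalue ?A k" using eigenvalue_root_char_poly[OF A] by blast
  then obtain z where z: "\<exists>v\<in>V. z v \<noteq> 0"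
      "\<And>v. v \<in> V \<Longrightarrow> (\<Sum>u\<in>V. of_real (adj E v u) * z u) = k * z v"
    unfolding matrix_eigenvalue_iff[OF h] by blast
  \<comment> \<open>The adjacency matrix is symmetric, so its Hermitian form takes real values and \<open>k\<close> is real.\<close>
  define Q where "Q = (\<Sum>v\<in>V. \<Sum>u\<in>V. of_real (adj E v u) * z u * cnj (z v))"
  define S where "S = (\<Sum>v\<in>V. (cmod (z v))\<^sup>2)"
  have "S > 0"
  proof -
    obtain v where "v \<in> V" "z v \<noteq> 0" using z(1) by blast
    then show ?thesis unfolding S_def using assms(1)
      by (intro sum_pos2[of V v]) auto
  qed
  have "Q = (\<Sum>v\<in>V. k * z v * cnj (z v))"
    unfolding Q_def using z(2) by (intro sum.cong) (auto simp: sum_distrib_right[symmetric])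
  also have "\<dots> = k * of_real S"
    unfolding S_def of_real_sum complex_norm_square by (simp add: sum_distrib_left mult.assoc)
  finally have Qk: "Q = k * of_real S" .
  have "cnj Q = (\<Sum>v\<in>V. \<Sum>u\<in>V. of_real (adj E v u) * cnj (z u) * z v)"
    unfolding Q_def by simp
  also have "\<dots> = (\<Sum>u\<in>V. \<Sum>v\<in>V. of_real (adj E v u) * cnj (z u) * z v)"
    by (rule sum.swap)
  also have "\<dots> = Q" unfolding Q_def by (simp add: adj_commute mult_ac)
  finally have "Im Q = 0" by (metis complex_cnj_cancel_iff cnj.simps(2) add.inverse_neutral equal_neg_zero)
  then have k: "k = of_real (Re k)" using Qk \<open>S > 0\<close> by (simp add: complex_eq_iff)
  have re: "(\<Sum>u\<in>V. adj E v u * Re (z u)) = Re k * Re (z v)"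
    and im: "(\<Sum>u\<in>V. adj E v u * Im (z u)) = Re k * Im (z v)" if "v \<in> V" for v
  proof -
    have e: "(\<Sum>u\<in>V. of_real (adj E v u) * z u) = of_real (Re k) * z v" using z(2)[OF that] k by simp
    show "(\<Sum>u\<in>V. adj E v u * Re (z u)) = Re k * Re (z v)"
      using arg_cong[OF e, of Re] by simp
    show "(\<Sum>u\<in>V. adj E v u * Im (z u)) = Re k * Im (z v)"
      using arg_cong[OF e, of Im] by simp
  qed
  obtain v where v: "v \<in> V" "Re (z v) \<noteq> 0 \<or> Im (z v) \<noteq> 0"
    using z(1) by (auto simp: complex_eq_iff)
  have "Re k \<in> adj_eigenvalues V E"
    using v(2)
  proof
    assume "Re (z v) \<noteq> 0"
    then show ?thesis unfolding adj_eigenvalues_def using re v(1)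
      by (intro CollectI exI[of _ "\<lambda>u. Re (z u)"]) blast
  next
    assume "Im (z v) \<noteq> 0"
    then show ?thesis unfolding adj_eigenvalues_def using im v(1)
      by (intro CollectI exI[of _ "\<lambda>u. Im (z u)"]) blast
  qed
  then show ?thesis by blast
qed

lemma spectral_radius_in_eigenvalues:
  "finite V \<Longrightarrow> V \<noteq> {} \<Longrightarrow> spectral_radius V E \<in> adj_eigenvalues V E"
  unfolding spectral_radius_def
  by (intro Max_in finite_adj_eigenvalues adj_eigenvalues_nonempty)

lemma eigenvalue_le_spectral_radius:
  "finite V \<Longrightarrow> mu \<in> adj_eigenvalues V E \<Longrightarrow> mu \<le> spectral_radius V E"
  unfolding spectral_radius_def by (intro Max_ge finite_adj_eigenvalues)

section \<open>Edge bound and strict monotonicity of eigenvalues\<close>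

lemma one_sided_eigenvalue_bound:
  fixes x :: "'a \<Rightarrow> real"
  assumes fin: "finite A" "finite B"
    and eq: "\<And>a. a \<in> A \<Longrightarrow> (\<Sum>b\<in>B. adj E a b * x b) = mu * x a"
  shows "mu\<^sup>2 * (\<Sum>a\<in>A. (x a)\<^sup>2) \<le> (\<Sum>a\<in>A. \<Sum>b\<in>B. adj E a b) * (\<Sum>b\<in>B. (x b)\<^sup>2)"
proof -
  have "mu\<^sup>2 * (x a)\<^sup>2 \<le> (\<Sum>b\<in>B. adj E a b) * (\<Sum>b\<in>B. (x b)\<^sup>2)" if "a \<in> A" for a
  proof -
    have "mu\<^sup>2 * (x a)\<^sup>2 = (\<Sum>b\<in>B. adj E a b * x b)\<^sup>2" using eq[OF that] by (simp add: power_mult_distrib)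
    also have "\<dots> \<le> (\<Sum>b\<in>B. (adj E a b)\<^sup>2) * (\<Sum>b\<in>B. (x b)\<^sup>2)" by (rule Cauchy_Schwarz_ineq_sum)
    also have "(\<Sum>b\<in>B. (adj E a b)\<^sup>2) = (\<Sum>b\<in>B. adj E a b)" by (intro sum.cong) (auto simp: adj_def)
    finally show ?thesis .
  qed
  then have "(\<Sum>a\<in>A. mu\<^sup>2 * (x a)\<^sup>2) \<le> (\<Sum>a\<in>A. (\<Sum>b\<in>B. adj E a b) * (\<Sum>b\<in>B. (x b)\<^sup>2))"
    by (rule sum_mono)
  then show ?thesis by (simp only: sum_distrib_left[symmetric] sum_distrib_right[symmetric])
qed

text \<open>Cauchy-Schwarz on each row, whose 0/1 entries equal their squares, gives one inequality
  per side; in their sum the squared norm of the eigenvector cancels. Treating the sides separately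
  yields the number of edges rather than twice that number.\<close>

lemma bipartite_eigenvalue_sq_le:
  assumes fin: "finite X" "finite Y" and dis: "X \<inter> Y = {}"
    and E: "\<And>e. e \<in> E \<Longrightarrow> \<exists>x\<in>X. \<exists>y\<in>Y. e = {x, y}"
    and mu: "mu \<in> adj_eigenvalues (X \<union> Y) E"
  shows "mu\<^sup>2 \<le> real (card {(x, y) \<in> X \<times> Y. {x, y} \<in> E})"
proof -
  obtain x where x: "\<exists>v\<in>X \<union> Y. x v \<noteq> 0"
    "\<And>v. v \<in> X \<union> Y \<Longrightarrow> (\<Sum>u\<in>X \<union> Y. adj E v u * x u) = mu * x v"
    using mu unfolding adj_eigenvalues_def by blast
  have no: "adj E u v = 0" if "(u \<in> X \<and> v \<in> X) \<or> (u \<in> Y \<and> v \<in> Y)" for u v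
  proof -
    have "{u, v} \<notin> E"
    proof
      assume "{u, v} \<in> E"
      then obtain a b where "a \<in> X" "b \<in> Y" "{u, v} = {a, b}" using E by blast
      then show False using that dis by (auto simp: doubleton_eq_iff)
    qed
    then show ?thesis by (simp add: adj_def)
  qed
  have split: "(\<Sum>u\<in>X \<union> Y. F u) = (\<Sum>u\<in>X. F u) + (\<Sum>u\<in>Y. F u)" for F :: "_ \<Rightarrow> real"
    using fin dis by (rule sum.union_disjoint)
  have eX: "(\<Sum>u\<in>Y. adj E v u * x u) = mu * x v" if "v \<in> X" for v
    using x(2)[of v] that no unfolding split by simp
  have eY: "(\<Sum>u\<in>X. adj E v u * x u) = mu * x v" if "v \<in> Y" for v
    using x(2)[of v] that no unfolding split by simp
  define e where "e = (\<Sum>a\<in>X. \<Sum>b\<in>Y. adj E a b)"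
  define P where "P = (\<Sum>a\<in>X. (x a)\<^sup>2)"
  define Q where "Q = (\<Sum>a\<in>Y. (x a)\<^sup>2)"
  have 1: "mu\<^sup>2 * P \<le> e * Q" unfolding e_def P_def Q_def
    by (rule one_sided_eigenvalue_bound[OF fin eX])
  have "(\<Sum>b\<in>Y. \<Sum>a\<in>X. adj E b a) = e" unfolding e_def by (subst sum.swap) (simp add: adj_commute)
  then have 2: "mu\<^sup>2 * Q \<le> e * P" unfolding P_def Q_def
    using one_sided_eigenvalue_bound[OF fin(2,1) eY] by simp
  have pos: "P + Q > 0"
  proof -
    obtain v where "v \<in> X \<union> Y" "x v \<noteq> 0" using x(1) by blast
    then have "(\<Sum>a\<in>X \<union> Y. (x a)\<^sup>2) > 0" using fin by (intro sum_pos2[of _ v]) auto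
    then show ?thesis unfolding P_def Q_def split .
  qed
  have "mu\<^sup>2 * (P + Q) \<le> e * (P + Q)" using 1 2 by (simp add: algebra_simps)
  then have "mu\<^sup>2 \<le> e" using pos by simp
  also have "e = (\<Sum>p\<in>X \<times> Y. if p \<in> {(x, y) \<in> X \<times> Y. {x, y} \<in> E} then 1 else 0)"
    unfolding e_def sum.cartesian_product by (intro sum.cong) (auto simp: adj_def split: if_splits)
  also have "\<dots> = real (card {(x, y) \<in> X \<times> Y. {x, y} \<in> E})"
    using fin by (subst sum.If_cases) (auto intro!: arg_cong[where f = card])
  finally show ?thesis .
qed

text \<open>A Perron-Frobenius comparison. If \<open>l \<le> mu\<close>, the absolute value
  \<open>y\<close> of an eigenvector for \<open>mu\<close> is paired with the positive vector
  \<open>z\<close>. The slacks \<open>F\<close> and \<open>D\<close> are non-negative but their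
  weighted sum vanishes, so \<open>y\<close> is zero at the end \<open>a\<close> of a missing edge,
  and connectedness spreads the zero everywhere.\<close>

lemma proper_subgraph_eigenvalue_less:
  assumes fin: "finite V" and sub: "E \<subseteq> E'"
    and z: "\<And>v. v \<in> V \<Longrightarrow> z v > 0"
    and eig: "\<And>v. v \<in> V \<Longrightarrow> (\<Sum>u\<in>V. adj E' v u * z u) = l * z v"
    and conn: "\<And>u v. u \<in> V \<Longrightarrow> v \<in> V \<Longrightarrow> reach V E u v"
    and new: "a \<in> V" "b \<in> V" "{a, b} \<in> E'" "{a, b} \<notin> E"
    and mu: "mu \<in> adj_eigenvalues V E"
  shows "mu < l"
proof (rule ccontr)
  assume "\<not> mu < l"
  then have ml: "l \<le> mu" by simp
  obtain x where x: "\<exists>v\<in>V. x v \<noteq> 0"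
    "\<And>v. v \<in> V \<Longrightarrow> (\<Sum>u\<in>V. adj E v u * x u) = mu * x v"
    using mu unfolding adj_eigenvalues_def by blast
  define y where "y v = \<bar>x v\<bar>" for v
  define F where "F v = (\<Sum>u\<in>V. adj E v u * y u) - l * y v" for v
  define D where "D u = l * z u - (\<Sum>v\<in>V. adj E u v * z v)" for u
  have y0: "y v \<ge> 0" for v by (simp add: y_def)
  have adj0: "adj E u v \<ge> 0" and adj_le: "adj E u v \<le> adj E' u v" for u v
    using sub by (auto simp: adj_def)
  have F0: "F v \<ge> 0" if "v \<in> V" for v
  proof -
    have "l * y v \<le> mu * y v" using ml y0 by (intro mult_right_mono) auto
    also have "\<dots> \<le> \<bar>mu * x v\<bar>" by (simp add: y_def abs_mult mult_right_mono)
    also have "\<dots> = \<bar>\<Sum>u\<in>V. adj E v u * x u\<bar>" using x(2)[OF that] by simp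
    also have "\<dots> \<le> (\<Sum>u\<in>V. \<bar>adj E v u * x u\<bar>)" by (rule sum_abs)
    also have "\<dots> = (\<Sum>u\<in>V. adj E v u * y u)" using adj0 by (simp add: abs_mult y_def)
    finally show ?thesis by (simp add: F_def)
  qed
  have Dsum: "D u = (\<Sum>v\<in>V. (adj E' u v - adj E u v) * z v)" if "u \<in> V" for u
    unfolding D_def using eig[OF that] by (simp add: left_diff_distrib sum_subtractf)
  have D0: "D u \<ge> 0" if "u \<in> V" for u
    unfolding Dsum[OF that] using adj_le z by (intro sum_nonneg mult_nonneg_nonneg) (auto intro: less_imp_le)
  have Da: "D a > 0" unfolding Dsum[OF new(1)] using fin new adj_le z
    by (intro sum_pos2[of V b] mult_nonneg_nonneg) (auto simp: adj_def intro: less_imp_le)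
  have "(\<Sum>v\<in>V. z v * (\<Sum>u\<in>V. adj E v u * y u)) = (\<Sum>v\<in>V. \<Sum>u\<in>V. z v * (adj E v u * y u))"
    by (simp add: sum_distrib_left)
  also have "\<dots> = (\<Sum>u\<in>V. \<Sum>v\<in>V. z v * (adj E v u * y u))" by (rule sum.swap)
  also have "\<dots> = (\<Sum>u\<in>V. y u * (\<Sum>v\<in>V. adj E u v * z v))"
    by (simp add: sum_distrib_left adj_commute mult_ac)
  finally have sw: "(\<Sum>v\<in>V. z v * (\<Sum>u\<in>V. adj E v u * y u)) = (\<Sum>u\<in>V. y u * (\<Sum>v\<in>V. adj E u v * z v))" .
  \<comment> \<open>Symmetry of the matrix makes the two sums opposite numbers; as neither is
    negative, every single term is zero.\<close>
  have "(\<Sum>v\<in>V. z v * F v) + (\<Sum>u\<in>V. y u * D u) = 0"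
    unfolding F_def D_def right_diff_distrib sum_subtractf sw by (simp add: mult_ac)
  moreover have zF: "z v * F v \<ge> 0" and yD: "y v * D v \<ge> 0" if "v \<in> V" for v
    using F0 D0 y0 z that by (simp_all add: less_imp_le)
  ultimately have "(\<Sum>v\<in>V. z v * F v) = 0" "(\<Sum>u\<in>V. y u * D u) = 0"
    using sum_nonneg[of V "\<lambda>v. z v * F v"] sum_nonneg[of V "\<lambda>v. y v * D v"] by fastforce+
  then have all0: "z v * F v = 0" "y v * D v = 0" if "v \<in> V" for v
    using sum_nonneg_eq_0_iff[OF fin, of "\<lambda>v. z v * F v"] sum_nonneg_eq_0_iff[OF fin, of "\<lambda>v. y v * D v"]
      zF yD that by auto
  have ya: "y a = 0" using all0(2)[OF new(1)] Da by simp
  have step: "y w = 0" if "v \<in> V" "w \<in> V" "{v, w} \<in> E" "y v = 0" for v w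
  proof -
    have "F v = 0" using all0(1)[OF that(1)] z[OF that(1)] by simp
    then have "(\<Sum>u\<in>V. adj E v u * y u) = 0" using that by (simp add: F_def)
    then have "adj E v w * y w = 0"
      using sum_nonneg_eq_0_iff[OF fin, of "\<lambda>u. adj E v u * y u"] adj0 y0 that by simp
    then show ?thesis using that by (simp add: adj_def)
  qed
  have "y v = 0" if "v \<in> V" for v
    using conn[OF new(1) that] unfolding reach_def
    by (induction rule: rtranclp_induct) (use ya step in auto)
  then show False using x(1) by (auto simp: y_def)
qed

section \<open>An explicit positive eigenvector of \<open>G_{n,n}\<close>\<close>

lemma Gnn_E_iff:
  assumes "i \<in> {1..n}" "j \<in> {1..n}"
  shows "{Inl i, Inr j} \<in> Gnn_E n \<longleftrightarrow> j \<ge> 4 \<or> i = 1 \<or> i = j + 1"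
proof -
  have "j \<ge> 4 \<or> j \<in> {1, 2, 3}" using assms by auto
  then show ?thesis using assms unfolding Gnn_E_def by (auto simp: doubleton_eq_iff)
qed

lemma Gnn_E_same_side:
  "{Inl i, Inl j} \<notin> Gnn_E n" "{Inr i, Inr j} \<notin> Gnn_E n"
  unfolding Gnn_E_def by (auto simp: doubleton_eq_iff)

text \<open>This serves twice: \<open>l\<close> bounds the spectral radius of \<open>G_{n,n}\<close>
  from below and so forces many edges in the given graph, and \<open>z\<close> is the positive
  vector for \<open>proper_subgraph_eigenvalue_less\<close>.\<close>

lemma Gnn_positive_eigenvector:
  assumes n: "n \<ge> 5"
  obtains l :: real and z where "l > 0" "l\<^sup>2 > real n * (real n - 3)"
    "\<And>v. v \<in> Gnn_X n \<union> Gnn_Y n \<Longrightarrow> z v > 0"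
    "\<And>v. v \<in> Gnn_X n \<union> Gnn_Y n \<Longrightarrow> (\<Sum>u\<in>Gnn_X n \<union> Gnn_Y n. adj (Gnn_E n) v u * z u) = l * z v"
proof -
  define m where "m = real n"
  have m: "m \<ge> 5" using n by (simp add: m_def)
  define M where "M = m * (m - 3)"
  have M: "M \<ge> 10" unfolding M_def using mult_mono[of 5 m 2 "m - 3"] m by simp
  \<comment> \<open>On the equitable partition of \<open>G\<^sub>n\<^sub>,\<^sub>n\<close> into the classes \<open>u\<^sub>1\<close>, \<open>u\<^sub>2-u\<^sub>4\<close>, \<open>u\<^sub>5-u\<^sub>n\<close>, \<open>v\<^sub>1-v\<^sub>3\<close>, \<open>v\<^sub>4-v\<^sub>n\<close>
    the square \<open>t\<close> of the eigenvalue satisfies \<open>(t - M) (t - 4) = 12 (n - 3)\<close>.\<close>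
  define R where "R = sqrt ((M - 4)\<^sup>2 + 48 * (m - 3))"
  define t where "t = (M + 4 + R) / 2"
  have R2: "R\<^sup>2 = (M - 4)\<^sup>2 + 48 * (m - 3)" unfolding R_def using m by simp
  have "R > M - 4"
  proof -
    have "sqrt ((M - 4)\<^sup>2) < R" unfolding R_def using m by (intro real_sqrt_less_mono) simp
    then show ?thesis using M by simp
  qed
  then have tM: "t > M" by (simp add: t_def)
  have "2 * t = M + 4 + R" by (simp add: t_def)
  then have "(2 * t - 2 * M) * (2 * t - 8) = (R - (M - 4)) * (R + (M - 4))" by (simp add: algebra_simps)
  also have "\<dots> = R\<^sup>2 - (M - 4)\<^sup>2" by (simp add: power2_eq_square algebra_simps)
  finally have tq: "(t - M) * (t - 4) = 12 * (m - 3)" using R2 by (simp add: algebra_simps)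
  \<comment> \<open>With the values of \<open>z\<close> below, the rows of
    \<open>v_1, v_2, v_3\<close> read \<open>t * s = 2 + 4 * s\<close>, which forces this
    \<open>s\<close>; the rows of the other \<open>v_j\<close> amount to \<open>tm\<close>.\<close>
  define s where "s = 2 / (t - 4)"
  have t4: "t > 4" using tM M by simp
  have s: "s > 0" using t4 by (simp add: s_def)
  have ts: "t * s = 2 + 4 * s" using t4 by (simp add: s_def field_simps)
  have "(t - M) = 6 * s * (m - 3)"
    using tq t4 by (simp add: s_def field_simps)
  then have tm: "t = (m - 3) * (m + 6 * s)" by (simp add: M_def algebra_simps)
  define l where "l = sqrt t"
  have l: "l > 0" "l * l = t" using t4 by (auto simp: l_def)
  define z where "z v = (case v of Inl i \<Rightarrow> if i = 1 then 1 + 3 * s else if i \<le> 4 then 1 + s else 1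
     | Inr j \<Rightarrow> if j \<le> 3 then l * s else l / (m - 3))" for v :: "nat + nat"
  have split: "(\<Sum>u\<in>Gnn_X n \<union> Gnn_Y n. F u) = (\<Sum>i\<in>{1..n}. F (Inl i)) + (\<Sum>j\<in>{1..n}. F (Inr j))"
    for F :: "_ \<Rightarrow> real"
    unfolding Gnn_X_def Gnn_Y_def
    by (subst sum.union_disjoint) (auto simp: sum.reindex)
  have d3: "(\<Sum>j\<in>{1..n}. F j) = F 1 + F 2 + F 3 + (\<Sum>j\<in>{4..n}. F j)" for F :: "nat \<Rightarrow> real"
  proof -
    have "{1..n} = {1, 2, 3} \<union> {4..n}" using n by auto
    then show ?thesis by (simp add: sum.union_disjoint)
  qed
  have d4: "(\<Sum>j\<in>{1..n}. F j) = F 1 + F 2 + F 3 + F 4 + (\<Sum>j\<in>{5..n}. F j)" for F :: "nat \<Rightarrow> real"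
  proof -
    have "{1..n} = {1, 2, 3, 4} \<union> {5..n}" using n by auto
    then show ?thesis by (simp add: sum.union_disjoint)
  qed
  have adjE: "adj (Gnn_E n) (Inl i) (Inr j) = (if j \<ge> 4 \<or> i = 1 \<or> i = j + 1 then 1 else 0)"
    if "i \<in> {1..n}" "j \<in> {1..n}" for i j
    using Gnn_E_iff[OF that] by (simp add: adj_def)
  have adj0: "adj (Gnn_E n) (Inl i) (Inl j) = 0" "adj (Gnn_E n) (Inr i) (Inr j) = 0" for i j
    by (simp_all add: adj_def Gnn_E_same_side)
  have rowX: "(\<Sum>j\<in>{1..n}. adj (Gnn_E n) (Inl i) (Inr j) * z (Inr j)) = l * z (Inl i)"
    if i: "i \<in> {1..n}" for i
  proof -
    have "(\<Sum>j\<in>{4..n}. adj (Gnn_E n) (Inl i) (Inr j) * z (Inr j)) = (\<Sum>j\<in>{4..n}. l / (m - 3))"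
      using i adjE by (intro sum.cong) (auto simp: z_def)
    also have "\<dots> = l" using m n by (simp add: m_def of_nat_diff)
    finally have "(\<Sum>j\<in>{4..n}. adj (Gnn_E n) (Inl i) (Inr j) * z (Inr j)) = l" .
    moreover have "i = 1 \<or> i = 2 \<or> i = 3 \<or> i = 4 \<or> i \<ge> 5" using i by auto
    ultimately show ?thesis unfolding d3 using i n adjE[of i 1] adjE[of i 2] adjE[of i 3]
      by (auto simp: z_def algebra_simps)
  qed
  have rowY: "(\<Sum>i\<in>{1..n}. adj (Gnn_E n) (Inr j) (Inl i) * z (Inl i)) = l * z (Inr j)"
    if j: "j \<in> {1..n}" for j
  proof (cases "j \<ge> 4")
    case True
    have "(\<Sum>i\<in>{1..n}. adj (Gnn_E n) (Inr j) (Inl i) * z (Inl i)) = (\<Sum>i\<in>{1..n}. z (Inl i))"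
      using j True adjE by (intro sum.cong) (auto simp: adj_commute[of _ "Inr j"])
    also have "(\<Sum>i\<in>{5..n}. z (Inl i)) = m - 4" using n by (simp add: z_def m_def of_nat_diff)
    then have "(\<Sum>i\<in>{1..n}. z (Inl i)) = m + 6 * s" unfolding d4 by (simp add: z_def)
    also have "\<dots> = l * z (Inr j)" using True tm l m by (simp add: z_def field_simps)
    finally show ?thesis .
  next
    case False
    have "(\<Sum>i\<in>{5..n}. adj (Gnn_E n) (Inr j) (Inl i) * z (Inl i)) = 0"
      using j False adjE by (intro sum.neutral) (auto simp: adj_commute[of _ "Inr j"])
    moreover have "j = 1 \<or> j = 2 \<or> j = 3" using j False by auto
    moreover have "l * (l * s) = 2 + 4 * s" using ts l by (simp add: mult.assoc[symmetric])
    ultimately show ?thesis unfolding d4 using n adjE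
      by (auto simp: z_def adj_commute[of _ "Inr _"])
  qed
  show ?thesis
  proof (rule that[of l z])
    show "l > 0" by fact
    show "l\<^sup>2 > real n * (real n - 3)" using tM l by (simp add: M_def m_def power2_eq_square)
    show "z v > 0" for v using s l m by (auto simp: z_def split: sum.split)
    fix v assume "v \<in> Gnn_X n \<union> Gnn_Y n"
    then show "(\<Sum>u\<in>Gnn_X n \<union> Gnn_Y n. adj (Gnn_E n) v u * z u) = l * z v"
      unfolding split using rowX rowY by (auto simp: adj0 Gnn_X_def Gnn_Y_def)
  qed
qed

section \<open>Alternating Hamilton cycles and the bipartite closure\<close>

lemma periodic_mod:
  fixes f :: "int \<Rightarrow> 'a"
  assumes "\<And>i. f (i + m) = f i"
  shows "f (i mod m) = f i"
proof -
  have *: "f (j + k * m) = f j" for j k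
  proof (induction k arbitrary: j rule: int_induct[where k = 0])
    case (step1 k)
    have "f (j + (k + 1) * m) = f ((j + k * m) + m)" by (simp add: algebra_simps)
    then show ?case using step1 assms by simp
  next
    case (step2 k)
    have "f (j + (k - 1) * m) = f ((j + (k - 1) * m) + m)" by (simp only: assms)
    also have "\<dots> = f (j + k * m)" by (simp add: algebra_simps)
    finally show ?case using step2 by simp
  qed simp
  show ?thesis using *[of "i mod m" "i div m"] by simp
qed

text \<open>A Hamilton cycle \<open>f 0, g 0, f 1, g 1, \<dots>\<close> of a bipartite graph, indexed by all integers with
  period \<open>n\<close>, so that rotating or reversing it is a mere change of index.\<close>
definition alt_cycle :: "'a set \<Rightarrow> 'a set \<Rightarrow> 'a set set \<Rightarrow> nat \<Rightarrow> bool" where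
  "alt_cycle X Y E n \<longleftrightarrow> (\<exists>f g :: int \<Rightarrow> 'a. range f = X \<and> range g = Y \<and>
     (\<forall>i. f (i + int n) = f i) \<and> (\<forall>i. g (i + int n) = g i) \<and>
     (\<forall>i. {f i, g i} \<in> E) \<and> (\<forall>i. {g i, f (i + 1)} \<in> E))"

text \<open>One period suffices: reducing indices modulo \<open>n\<close> extends it, and
  \<open>close\<close> is the edge across the seam.\<close>

lemma alt_cycleI:
  fixes f g :: "int \<Rightarrow> 'a"
  assumes n: "n > 0" and f: "f ` {0..<int n} = X" and g: "g ` {0..<int n} = Y"
    and fg: "\<And>i. 0 \<le> i \<Longrightarrow> i < int n \<Longrightarrow> {f i, g i} \<in> E"
    and gf: "\<And>i. 0 \<le> i \<Longrightarrow> i + 1 < int n \<Longrightarrow> {g i, f (i + 1)} \<in> E"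
    and close: "{g (int n - 1), f 0} \<in> E"
  shows "alt_cycle X Y E n"
proof -
  let ?f = "\<lambda>i. f (i mod int n)" and ?g = "\<lambda>i. g (i mod int n)"
  have r: "range (\<lambda>i. h (i mod int n)) = h ` {0..<int n}" for h :: "int \<Rightarrow> 'a"
  proof
    show "range (\<lambda>i. h (i mod int n)) \<subseteq> h ` {0..<int n}" using n by auto
    have "h i = h (i mod int n)" if "0 \<le> i" "i < int n" for i using that by simp
    then show "h ` {0..<int n} \<subseteq> range (\<lambda>i. h (i mod int n))" by fastforce
  qed
  have "{?g i, ?f (i + 1)} \<in> E" for i
  proof -
    have b: "0 \<le> i mod int n" "i mod int n < int n" using n by auto
    have e: "(i + 1) mod int n = (i mod int n + 1) mod int n" by (simp add: mod_add_left_eq)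
    show ?thesis
    proof (cases "i mod int n + 1 < int n")
      case True
      then show ?thesis using gf[of "i mod int n"] b e by simp
    next
      case False
      then have "i mod int n = int n - 1" using b by simp
      then show ?thesis using close e n by simp
    qed
  qed
  moreover have "{?f i, ?g i} \<in> E" for i using fg n by simp
  ultimately show ?thesis unfolding alt_cycle_def
    using r[of f] r[of g] f g by (intro exI[of _ ?f] exI[of _ ?g]) simp
qed

text \<open>Reading the same cycle from \<open>g 0\<close> on shifts \<open>f\<close> by
  one.\<close>

lemma alt_cycle_swap: "alt_cycle X Y E n \<Longrightarrow> alt_cycle Y X E n"
proof -
  assume "alt_cycle X Y E n"
  then obtain f g :: "int \<Rightarrow> 'a" where fg: "range f = X" "range g = Y"
    "\<And>i. f (i + int n) = f i" "\<And>i. g (i + int n) = g i"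
    "\<And>i. {f i, g i} \<in> E" "\<And>i. {g i, f (i + 1)} \<in> E"
    unfolding alt_cycle_def by blast
  have "range (\<lambda>i. f (i + 1)) = X"
  proof -
    have "f i \<in> range (\<lambda>i. f (i + 1))" for i by (rule range_eqI[of _ _ "i - 1"]) simp
    then show ?thesis using fg(1) by auto
  qed
  moreover have "f (i + int n + 1) = f (i + 1)" for i using fg(3)[of "i+1"] by (simp add: algebra_simps)
  ultimately show ?thesis unfolding alt_cycle_def using fg
    by (intro exI[of _ g] exI[of _ "\<lambda>i. f (i + 1)"]) (auto simp: insert_commute)
qed

lemma periodic_image:
  fixes f :: "int \<Rightarrow> 'a"
  assumes "\<And>i. f (i + int n) = f i" "n > 0"
  shows "f ` {0..<int n} = range f"
proof -
  have "f i \<in> f ` {0..<int n}" for i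
    using periodic_mod[of f "int n" i] assms
    by (intro image_eqI[of _ _ "i mod int n"]) auto
  then show ?thesis by auto
qed

lemma periodic_inj:
  fixes f :: "int \<Rightarrow> 'a"
  assumes "\<And>i. f (i + int n) = f i" "n > 0" "card (range f) = n"
  shows "inj_on f {0..<int n}"
  using periodic_image[of f n] assms by (intro eq_card_imp_inj_on) auto

lemma alt_cycle_hamiltonian:
  assumes c: "alt_cycle X Y E n" and XY: "X \<inter> Y = {}" "card X = n" "card Y = n" and n: "n \<ge> 2"
  shows "hamiltonian (X \<union> Y) E"
proof -
  obtain f g :: "int \<Rightarrow> 'a" where fg: "range f = X" "range g = Y"
    "\<And>i. f (i + int n) = f i" "\<And>i. g (i + int n) = g i"
    "\<And>i. {f i, g i} \<in> E" "\<And>i. {g i, f (i + 1)} \<in> E"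
    using c unfolding alt_cycle_def by blast
  have inj: "inj_on f {0..<int n}" "inj_on g {0..<int n}"
    using periodic_inj[of f n] periodic_inj[of g n] fg XY n by auto
  \<comment> \<open>Positions \<open>2 * i\<close> and \<open>2 * i + 1\<close> of the list carry
    \<open>f i\<close> and \<open>g i\<close>. Since the sides are disjoint, equal values have
    positions of equal parity, so injectivity reduces to that of \<open>f\<close> and
    \<open>g\<close>.\<close>
  define h where "h k = (if even k then f (int (k div 2)) else g (int (k div 2)))" for k :: nat
  define vs where "vs = map h [0..<2*n]"
  have fX: "f i \<in> X" and gY: "g i \<in> Y" for i using fg by auto
  have "inj_on h {0..<2*n}"
  proof (rule inj_onI)
    fix k l assume kl: "k \<in> {0..<2*n}" "l \<in> {0..<2*n}" "h k = h l"
    have par: "even k \<longleftrightarrow> even l" using kl(3) fX gY XY(1) unfolding h_def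
      by (metis IntI empty_iff)
    have b: "int (k div 2) \<in> {0..<int n}" "int (l div 2) \<in> {0..<int n}" using kl by auto
    have "int (k div 2) = int (l div 2)"
    proof (cases "even k")
      case True
      then show ?thesis using kl(3) par inj_onD[OF inj(1) _ b] unfolding h_def by simp
    next
      case False
      then show ?thesis using kl(3) par inj_onD[OF inj(2) _ b] unfolding h_def by simp
    qed
    then have "k div 2 = l div 2" by simp
    then show "k = l" using par by presburger
  qed
  then have dist: "distinct vs" unfolding vs_def by (simp add: distinct_map)
  have "card (set vs) = 2 * n" using dist distinct_card[of vs] by (simp add: vs_def)
  moreover have "set vs \<subseteq> X \<union> Y" using fX gY unfolding vs_def h_def by auto
  moreover have fin: "finite (X \<union> Y)" using XY n by (auto intro!: card_ge_0_finite)
  moreover have "card (X \<union> Y) = 2 * n" using XY fin by (subst card_Un_disjoint) auto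
  ultimately have set: "set vs = X \<union> Y" by (metis card_subset_eq)
  have "{vs ! i, vs ! ((i + 1) mod length vs)} \<in> E" if "i < length vs" for i
  proof -
    have i: "i < 2 * n" using that by (simp add: vs_def)
    have v: "vs ! j = h j" if "j < 2 * n" for j using that by (simp add: vs_def)
    have hn: "h (2 * n) = h 0" using fg(3)[of 0] by (simp add: h_def)
    have "vs ! ((i + 1) mod length vs) = h (i + 1)"
    proof (cases "i + 1 < 2 * n")
      case True then show ?thesis using v by (simp add: vs_def)
    next
      case False
      then have "i + 1 = 2 * n" using i by simp
      then show ?thesis using v[of 0] hn n by (simp add: vs_def)
    qed
    moreover have "{h i, h (i + 1)} \<in> E"
    proof (cases "even i")
      case True
      then have "(i + 1) div 2 = i div 2" by simp
      then show ?thesis using True fg(5) by (simp add: h_def)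
    next
      case False
      then have "(i + 1) div 2 = i div 2 + 1" by presburger
      then show ?thesis using False fg(6)[of "int (i div 2)"] by (simp add: h_def add.commute)
    qed
    ultimately show ?thesis using v i by simp
  qed
  then show ?thesis unfolding hamiltonian_def using dist set n
    by (intro exI[of _ vs]) (auto simp: vs_def)
qed

definition nbr :: "'a set set \<Rightarrow> 'a set \<Rightarrow> 'a \<Rightarrow> 'a set" where
  "nbr E S v = {u \<in> S. {v, u} \<in> E}"

text \<open>The cycle must use the new edge; cutting it there leaves a Hamilton path of the old
  graph, normalised to start in \<open>x\<close> and end in \<open>y\<close>. Rotation achieves this
  if the edge leads from \<open>y\<close> to \<open>x\<close> along the cycle, reversal
  otherwise.\<close>

lemma alt_cycle_path:
  assumes c: "alt_cycle X Y (insert {x, y} E) n" and nc: "\<not> alt_cycle X Y E n"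
    and x: "x \<in> X" and y: "y \<in> Y" and XY: "X \<inter> Y = {}" "card X = n" "card Y = n" and n: "n \<ge> 2"
  obtains f g :: "int \<Rightarrow> 'a" where "f ` {0..<int n} = X" "g ` {0..<int n} = Y"
    "inj_on f {0..<int n}" "inj_on g {0..<int n}"
    "f 0 = x" "g (int n - 1) = y"
    "\<And>i. 0 \<le> i \<Longrightarrow> i < int n \<Longrightarrow> {f i, g i} \<in> E"
    "\<And>i. 0 \<le> i \<Longrightarrow> i + 1 < int n \<Longrightarrow> {g i, f (i + 1)} \<in> E"
proof -
  let ?E = "insert {x, y} E"
  obtain f g :: "int \<Rightarrow> 'a" where fg: "range f = X" "range g = Y"
    "\<And>i. f (i + int n) = f i" "\<And>i. g (i + int n) = g i"
    "\<And>i. {f i, g i} \<in> ?E" "\<And>i. {g i, f (i + 1)} \<in> ?E"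
    using c unfolding alt_cycle_def by blast
  have neq: "f i \<noteq> y" "g i \<noteq> x" for i
    using rangeI[of f i] rangeI[of g i] fg(1,2) x y XY(1) by blast+
  have "\<exists>i. {f i, g i} = {x, y} \<or> {g i, f (i + 1)} = {x, y}"
  proof (rule ccontr)
    assume "\<not> ?thesis"
    then have "\<And>i. {f i, g i} \<in> E" "\<And>i. {g i, f (i + 1)} \<in> E" using fg(5,6) by blast+
    then show False using nc fg unfolding alt_cycle_def by blast
  qed
  then obtain i where i: "{f i, g i} = {x, y} \<or> {g i, f (i + 1)} = {x, y}" ..
  have "\<exists>f g :: int \<Rightarrow> 'a. range f = X \<and> range g = Y \<and> (\<forall>i. f (i + int n) = f i) \<and>
     (\<forall>i. g (i + int n) = g i) \<and> (\<forall>i. {f i, g i} \<in> ?E) \<and> (\<forall>i. {g i, f (i + 1)} \<in> ?E) \<and>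
     f 0 = x \<and> g (- 1) = y"
    using i
  proof
    assume "{f i, g i} = {x, y}"
    then have xy: "f i = x" "g i = y" using neq by (auto simp: doubleton_eq_iff)
    \<comment> \<open>Reversal: \<open>x = f i\<close> moves to index 0, and its new predecessor
      \<open>y = g i\<close> to index -1, which is \<open>n - 1\<close> by periodicity.\<close>
    let ?f = "\<lambda>j. f (i - j)" and ?g = "\<lambda>j. g (i - 1 - j)"
    have "f k \<in> range ?f" "g k \<in> range ?g" for k
      by (rule range_eqI[of _ _ "i - k"], simp) (rule range_eqI[of _ _ "i - 1 - k"], simp)
    then have "range ?f = X" "range ?g = Y" using fg(1,2) by auto
    moreover have "?f (j + int n) = ?f j" "?g (j + int n) = ?g j" for j
      using fg(3)[of "i - j - int n"] fg(4)[of "i - 1 - j - int n"] by (simp_all add: algebra_simps)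
    moreover have "{?f j, ?g j} \<in> ?E" "{?g j, ?f (j + 1)} \<in> ?E" for j
      using fg(6)[of "i - 1 - j"] fg(5)[of "i - 1 - j"] by (simp_all add: insert_commute algebra_simps)
    ultimately show ?thesis using xy by (intro exI[of _ ?f] exI[of _ ?g]) simp
  next
    assume "{g i, f (i + 1)} = {x, y}"
    then have xy: "f (i + 1) = x" "g i = y" using neq by (auto simp: doubleton_eq_iff)
    let ?f = "\<lambda>j. f (j + (i + 1))" and ?g = "\<lambda>j. g (j + (i + 1))"
    have "f k \<in> range ?f" "g k \<in> range ?g" for k
      by (rule range_eqI[of _ _ "k - (i + 1)"], simp)+
    then have "range ?f = X" "range ?g = Y" using fg(1,2) by auto
    moreover have "?f (j + int n) = ?f j" "?g (j + int n) = ?g j" for j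
      using fg(3)[of "j + (i + 1)"] fg(4)[of "j + (i + 1)"] by (simp_all add: algebra_simps)
    moreover have "{?f j, ?g j} \<in> ?E" "{?g j, ?f (j + 1)} \<in> ?E" for j
      using fg(5)[of "j + (i + 1)"] fg(6)[of "j + (i + 1)"] by (simp_all add: algebra_simps)
    ultimately show ?thesis using xy by (intro exI[of _ ?f] exI[of _ ?g]) simp
  qed
  then obtain f g :: "int \<Rightarrow> 'a" where fg: "range f = X" "range g = Y"
    "\<And>i. f (i + int n) = f i" "\<And>i. g (i + int n) = g i"
    "\<And>i. {f i, g i} \<in> ?E" "\<And>i. {g i, f (i + 1)} \<in> ?E" "f 0 = x" "g (- 1) = y" by blast
  have im: "f ` {0..<int n} = X" "g ` {0..<int n} = Y"
    using periodic_image[of f n] periodic_image[of g n] fg n by auto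
  have inj: "inj_on f {0..<int n}" "inj_on g {0..<int n}"
    using periodic_inj[of f n] periodic_inj[of g n] fg XY n by auto
  have gn: "g (int n - 1) = y" using fg(4)[of "-1"] fg(8) by simp
  \<comment> \<open>Within one period \<open>x\<close> and \<open>y\<close> occur once each, so the
    new edge appears only at the seam and all path edges are old.\<close>
  have f0: "i = 0" if "0 \<le> i" "i < int n" "f i = x" for i
    using inj_onD[OF inj(1), of i 0] that fg(7) n by simp
  have g0: "i = int n - 1" if "0 \<le> i" "i < int n" "g i = y" for i
    using inj_onD[OF inj(2), of i "int n - 1"] that gn n by simp
  have neq: "f i \<noteq> y" "g i \<noteq> x" for i
    using rangeI[of f i] rangeI[of g i] fg(1,2) x y XY(1) by blast+
  show ?thesis
  proof (rule that[OF im inj fg(7) gn])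
    fix i :: int assume i: "0 \<le> i" "i < int n"
    have "{f i, g i} \<noteq> {x, y}"
      using f0[OF i] g0[OF i] n neq by (auto simp: doubleton_eq_iff)
    then show "{f i, g i} \<in> E" using fg(5)[of i] by simp
  next
    fix i :: int assume i: "0 \<le> i" "i + 1 < int n"
    have "{g i, f (i + 1)} \<noteq> {x, y}"
      using f0[of "i + 1"] i neq by (auto simp: doubleton_eq_iff)
    then show "{g i, f (i + 1)} \<in> E" using fg(6)[of i] by simp
  qed
qed

text \<open>The crossing argument of Bondy and Chvatal on the Hamilton path from \<open>x\<close> to
  \<open>y\<close>: the index sets \<open>?I\<close> and \<open>?J\<close> have more than
  \<open>n\<close> elements together, so some \<open>i\<close> has \<open>x\<close> adjacent to
  \<open>g i\<close> and \<open>f i\<close> adjacent to \<open>y\<close>.\<close>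

lemma bipartite_closure_step:
  assumes c: "alt_cycle X Y (insert {x, y} E) n"
    and x: "x \<in> X" and y: "y \<in> Y" and XY: "X \<inter> Y = {}" "card X = n" "card Y = n" and n: "n \<ge> 2"
    and deg: "card (nbr E Y x) + card (nbr E X y) > n"
  shows "alt_cycle X Y E n"
proof (rule ccontr)
  assume nc: "\<not> alt_cycle X Y E n"
  obtain f g :: "int \<Rightarrow> 'a" where im: "f ` {0..<int n} = X" "g ` {0..<int n} = Y"
    and inj: "inj_on f {0..<int n}" "inj_on g {0..<int n}"
    and end_pts: "f 0 = x" "g (int n - 1) = y"
    and fg: "\<And>i. 0 \<le> i \<Longrightarrow> i < int n \<Longrightarrow> {f i, g i} \<in> E"
    and gf: "\<And>i. 0 \<le> i \<Longrightarrow> i + 1 < int n \<Longrightarrow> {g i, f (i + 1)} \<in> E"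
    using alt_cycle_path[OF c nc x y XY n] by metis
  let ?I = "{i \<in> {0..<int n}. {x, g i} \<in> E}" and ?J = "{i \<in> {0..<int n}. {f i, y} \<in> E}"
  have fin: "finite ?I" "finite ?J" by (rule finite_subset[of _ "{0..<int n}"]; auto)+
  have "nbr E Y x = g ` ?I" using im unfolding nbr_def by auto
  then have I: "card ?I = card (nbr E Y x)"
    using card_image[OF inj_on_subset[OF inj(2), of ?I]] by (simp add: subset_iff)
  have "nbr E X y = f ` ?J" using im unfolding nbr_def by (auto simp: insert_commute)
  then have J: "card ?J = card (nbr E X y)"
    using card_image[OF inj_on_subset[OF inj(1), of ?J]] by (simp add: subset_iff)
  have "?I \<inter> ?J \<noteq> {}"
  proof
    assume "?I \<inter> ?J = {}"
    then have "card (?I \<union> ?J) = card ?I + card ?J" using fin by (intro card_Un_disjoint)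
    moreover have "card (?I \<union> ?J) \<le> card {0..<int n}" by (intro card_mono) auto
    ultimately show False using I J deg by simp
  qed
  then obtain i where i: "0 \<le> i" "i < int n" and cross: "{x, g i} \<in> E" "{f i, y} \<in> E" by auto
  \<comment> \<open>The new cycle follows the path from \<open>x\<close> to \<open>f i\<close>,
    jumps to \<open>y\<close>, runs back along the path to \<open>g i\<close> and returns to
    \<open>x\<close>. The path edge between \<open>f i\<close> and \<open>g i\<close> is
    dropped.\<close>
  let ?f = "\<lambda>j. if j \<le> i then f j else f (int n + i - j)"
  let ?g = "\<lambda>j. if j < i then g j else g (int n - 1 + i - j)"
  have fim: "?f ` {0..<int n} = X"
  proof
    show "?f ` {0..<int n} \<subseteq> X" using i im(1) by auto
    show "X \<subseteq> ?f ` {0..<int n}"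
    proof
      fix u assume "u \<in> X"
      then obtain k where k: "0 \<le> k" "k < int n" "u = f k" using im by auto
      show "u \<in> ?f ` {0..<int n}"
        by (rule image_eqI[of _ _ "if k \<le> i then k else int n + i - k"]) (use k i in auto)
    qed
  qed
  have gim: "?g ` {0..<int n} = Y"
  proof
    show "?g ` {0..<int n} \<subseteq> Y" using i im(2) by auto
    show "Y \<subseteq> ?g ` {0..<int n}"
    proof
      fix u assume "u \<in> Y"
      then obtain k where k: "0 \<le> k" "k < int n" "u = g k" using im by auto
      show "u \<in> ?g ` {0..<int n}"
        by (rule image_eqI[of _ _ "if k < i then k else int n - 1 + i - k"]) (use k i in auto)
    qed
  qed
  have "alt_cycle X Y E n"
  proof (rule alt_cycleI[OF _ fim gim])
    fix j :: int assume j: "0 \<le> j" "j < int n"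
    consider "j < i" | "j = i" | "j > i" by linarith
    then show "{?f j, ?g j} \<in> E"
    proof cases
      case 1 then show ?thesis using fg j by simp
    next
      case 2 then show ?thesis using cross end_pts by simp
    next
      case 3
      then show ?thesis using gf[of "int n - 1 + i - j"] i j by (simp add: insert_commute algebra_simps)
    qed
  next
    fix j :: int assume j: "0 \<le> j" "j + 1 < int n"
    show "{?g j, ?f (j + 1)} \<in> E"
    proof (cases "j < i")
      case True then show ?thesis using gf j by simp
    next
      case False
      then show ?thesis using fg[of "int n - 1 + i - j"] i j by (simp add: insert_commute algebra_simps)
    qed
  next
    show "{?g (int n - 1), ?f 0} \<in> E" using i cross end_pts by (simp add: insert_commute)
  qed (use n in simp)
  with nc show False ..
qed

lemma nbr_subset: "nbr E S v \<subseteq> S"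
  by (auto simp: nbr_def)

lemma nbrD: "u \<in> nbr E S v \<Longrightarrow> u \<in> S"
  by (simp add: nbr_def)

section \<open>Explicit Hamilton cycles\<close>

lemma alt_cycle_of_lists:
  assumes n: "n > 0" "length xs = n" "length ys = n" and s: "set xs = X" "set ys = Y"
    and xy: "\<And>i. i < n \<Longrightarrow> {xs ! i, ys ! i} \<in> E"
    and yx: "\<And>i. Suc i < n \<Longrightarrow> {ys ! i, xs ! Suc i} \<in> E"
    and close: "{ys ! (n - 1), xs ! 0} \<in> E"
  shows "alt_cycle X Y E n"
proof (rule alt_cycleI[OF n(1), of "\<lambda>i. xs ! nat i" _ "\<lambda>i. ys ! nat i"])
  have im: "(\<lambda>i. zs ! nat i) ` {0..<int n} = set zs" if "length zs = n" for zs :: "'a list"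
  proof -
    have "zs ! i \<in> (\<lambda>i. zs ! nat i) ` {0..<int n}" if "i < n" for i
      using that by (intro image_eqI[of _ _ "int i"]) auto
    moreover have "zs ! nat i \<in> set zs" if "0 \<le> i" "i < int n" for i
      using that \<open>length zs = n\<close> by simp
    ultimately show ?thesis using that by (auto simp: in_set_conv_nth)
  qed
  show "(\<lambda>i. xs ! nat i) ` {0..<int n} = X" "(\<lambda>i. ys ! nat i) ` {0..<int n} = Y"
    using im n s by auto
  show "{xs ! nat i, ys ! nat i} \<in> E" if "0 \<le> i" "i < int n" for i using xy that by simp
  show "{ys ! nat i, xs ! nat (i + 1)} \<in> E" if "0 \<le> i" "i + 1 < int n" for i
    using yx[of "nat i"] that by (simp add: nat_add_distrib)
  show "{ys ! nat (int n - 1), xs ! nat 0} \<in> E" using close by (simp add: nat_diff_distrib')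
qed

lemma complete_alt_cycle:
  assumes "card X = n" "card Y = n" "n > 0" and E: "\<And>x y. x \<in> X \<Longrightarrow> y \<in> Y \<Longrightarrow> {x, y} \<in> E"
  shows "alt_cycle X Y E n"
proof -
  have "finite X" "finite Y" using assms by (auto intro: card_ge_0_finite)
  then obtain xs ys where xs: "set xs = X" "distinct xs" and ys: "set ys = Y" "distinct ys"
    using finite_distinct_list by metis
  then have l: "length xs = n" "length ys = n" using assms distinct_card by metis+
  have "{xs ! i, ys ! j} \<in> E" "{ys ! j, xs ! i} \<in> E" if "i < n" "j < n" for i j
    using E xs ys l that by (auto simp: insert_commute)
  then show ?thesis using assms(3) xs ys l by (intro alt_cycle_of_lists[of n xs ys]) auto
qed

text \<open>Each \<open>v_i\<close> is placed between its own two neighbours, and vertices joined to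
  all of \<open>X\<close> link the pieces: \<open>a0 v1 a1 w1 a2 v2 a3 w2 a4 v3 a5\<close>, then the
  remaining vertices in any order.\<close>

lemma three_disjoint_alt_cycle:
  assumes XY: "card X = n" "card Y = n" "n \<ge> 6" "X \<inter> Y = {}"
    and v: "distinct [v1, v2, v3]" "{v1, v2, v3} \<subseteq> Y"
    and full: "\<And>x y. x \<in> X \<Longrightarrow> y \<in> Y - {v1, v2, v3} \<Longrightarrow> {x, y} \<in> E"
    and a: "distinct [a0, a1, a2, a3, a4, a5]"
    and N: "nbr E X v1 = {a0, a1}" "nbr E X v2 = {a2, a3}" "nbr E X v3 = {a4, a5}"
  shows "alt_cycle X Y E n"
proof -
  have fin: "finite X" "finite Y" using XY by (auto intro: card_ge_0_finite)
  have aX: "{a0, a1, a2, a3, a4, a5} \<subseteq> X"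
    using N nbr_subset[of E X v1] nbr_subset[of E X v2] nbr_subset[of E X v3] by auto
  obtain r where r: "set r = X - {a0, a1, a2, a3, a4, a5}" "distinct r"
    using fin finite_distinct_list by (metis finite_Diff)
  obtain q where q: "set q = Y - {v1, v2, v3}" "distinct q"
    using fin finite_distinct_list by (metis finite_Diff)
  have "card (set q) = n - 3" using q v XY fin by (simp add: card_Diff_subset)
  then have lq: "length q = n - 3" using q distinct_card by metis
  obtain w1 w2 q' where q': "q = w1 # w2 # q'"
  proof (cases q)
    case Nil then show ?thesis using lq XY by simp
  next
    case (Cons w1 p)
    then show ?thesis using lq XY that by (cases p) auto
  qed
  define xs where "xs = [a0, a1, a2, a3, a4, a5] @ r"
  define ys where "ys = [v1, w1, v2, w2, v3] @ q'"
  have xs: "set xs = X" "distinct xs" using aX a r by (auto simp: xs_def)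
  have ys: "set ys = Y" "distinct ys" using v q unfolding q' by (auto simp: ys_def)
  have l: "length xs = n" "length ys = n" using XY xs ys distinct_card by metis+
  have nb: "{x, v1} \<in> E" if "x \<in> {a0, a1}" for x using that N(1) by (auto simp: nbr_def insert_commute)
  have nb2: "{x, v2} \<in> E" if "x \<in> {a2, a3}" for x using that N(2) by (auto simp: nbr_def insert_commute)
  have nb3: "{x, v3} \<in> E" if "x \<in> {a4, a5}" for x using that N(3) by (auto simp: nbr_def insert_commute)
  \<comment> \<open>Only positions 0, 2, 4 of \<open>ys\<close> hold restricted vertices;
    \<open>n \<ge> 6\<close> keeps the closing position \<open>n - 1\<close> away from them.\<close>
  have gen: "{xs ! i, ys ! j} \<in> E" if ij: "i < n" "j < n" "j \<notin> {0, 2, 4}" for i j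
  proof (rule full)
    show "xs ! i \<in> X" using ij l xs by auto
    have "ys ! 0 = v1" "ys ! 2 = v2" "ys ! 4 = v3" by (simp_all add: ys_def)
    moreover have "ys ! j \<noteq> ys ! k" if "k \<in> {0, 2, 4}" for k
    proof -
      have "k < length ys" "j < length ys" "j \<noteq> k" using that ij l XY(3) by auto
      then show ?thesis using nth_eq_iff_index_eq[OF ys(2)] by blast
    qed
    ultimately have "ys ! j \<noteq> v1" "ys ! j \<noteq> v2" "ys ! j \<noteq> v3" by (metis insertCI)+
    then show "ys ! j \<in> Y - {v1, v2, v3}" using ij l ys by auto
  qed
  show ?thesis
  proof (rule alt_cycle_of_lists[OF _ l xs(1) ys(1)])
    fix i assume i: "i < n"
    show "{xs ! i, ys ! i} \<in> E"
    proof (cases "i \<in> {0, 2, 4}")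
      case True
      then show ?thesis using nb nb2 nb3 by (auto simp: xs_def ys_def)
    qed (use gen i in blast)
  next
    fix i assume i: "Suc i < n"
    show "{ys ! i, xs ! Suc i} \<in> E"
    proof (cases "i \<in> {0, 2, 4}")
      case True
      then show ?thesis using nb nb2 nb3 by (auto simp: xs_def ys_def insert_commute)
    next
      case False
      then show ?thesis using gen[of "Suc i" i] i by (simp add: insert_commute)
    qed
  next
    show "{ys ! (n - 1), xs ! 0} \<in> E"
    proof -
      have "0 < n" "n - 1 < n" "n - 1 \<notin> {0, 2, 4}" using XY(3) by auto
      then show ?thesis by (subst insert_commute) (rule gen)
    qed
  qed (use XY in simp)
qed

section \<open>The extremal graph\<close>

lemma graph_iso_sym:
  assumes "graph_iso V E V' E'"
  shows "graph_iso V' E' V E"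
proof -
  obtain f where f: "bij_betw f V V'" "\<And>u v. u \<in> V \<Longrightarrow> v \<in> V \<Longrightarrow> {u, v} \<in> E \<longleftrightarrow> {f u, f v} \<in> E'"
    using assms unfolding graph_iso_def by blast
  let ?g = "inv_into V f"
  have g: "bij_betw ?g V' V" using f(1) by (rule bij_betw_inv_into)
  have "{u, v} \<in> E' \<longleftrightarrow> {?g u, ?g v} \<in> E" if "u \<in> V'" "v \<in> V'" for u v
    using f(2)[of "?g u" "?g v"] that bij_betw_apply[OF g] bij_betw_inv_into_right[OF f(1)] by simp
  then show ?thesis unfolding graph_iso_def using g by blast
qed

text \<open>The map is built starting from \<open>G_{n,n}\<close>, whose vertices come numbered:
  \<open>xs\<close> and \<open>ys\<close> list the given vertices in the order of the
  \<open>u_i\<close> and \<open>v_j\<close>, with \<open>a\<close> as \<open>u_1\<close> and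
  \<open>b1, b2, b3\<close> as \<open>u_2, u_3, u_4\<close>.\<close>

lemma extremal_graph_iso:
  assumes dis: "X \<inter> Y = {}" and card: "card X = n" "card Y = n" and n: "n \<ge> 4"
    and bip: "\<And>e. e \<in> E \<Longrightarrow> \<exists>x\<in>X. \<exists>y\<in>Y. e = {x, y}"
    and v: "distinct [v1, v2, v3]" "{v1, v2, v3} \<subseteq> Y" and b: "distinct [a, b1, b2, b3]"
    and N: "nbr E X v1 = {a, b1}" "nbr E X v2 = {a, b2}" "nbr E X v3 = {a, b3}"
    and full: "\<And>x y. x \<in> X \<Longrightarrow> y \<in> Y - {v1, v2, v3} \<Longrightarrow> {x, y} \<in> E"
  shows "graph_iso (X \<union> Y) E (Gnn_X n \<union> Gnn_Y n) (Gnn_E n)"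
proof (rule graph_iso_sym)
  have fin: "finite X" "finite Y" using card n by (auto intro: card_ge_0_finite)
  have bX: "{a, b1, b2, b3} \<subseteq> X"
    using N nbr_subset[of E X v1] nbr_subset[of E X v2] nbr_subset[of E X v3] by auto
  obtain r where r: "set r = X - {a, b1, b2, b3}" "distinct r"
    using fin finite_distinct_list by (metis finite_Diff)
  obtain q where q: "set q = Y - {v1, v2, v3}" "distinct q"
    using fin finite_distinct_list by (metis finite_Diff)
  define xs where "xs = [a, b1, b2, b3] @ r"
  define ys where "ys = [v1, v2, v3] @ q"
  have xs: "set xs = X" "distinct xs" using bX b r by (auto simp: xs_def)
  have ys: "set ys = Y" "distinct ys" using v q by (auto simp: ys_def)
  have l: "length xs = n" "length ys = n" using card xs ys distinct_card by metis+
  \<comment> \<open>The vertices of \<open>G_{n,n}\<close> are numbered from 1, list positions from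
    0.\<close>
  define g where "g = case_sum (\<lambda>i. xs ! (i - 1)) (\<lambda>j. ys ! (j - 1))"
  have gX: "g (Inl i) = xs ! (i - 1)" "xs ! (i - 1) \<in> X"
    and gY: "g (Inr i) = ys ! (i - 1)" "ys ! (i - 1) \<in> Y" if "i \<in> {1..n}" for i
    using that xs ys l by (auto simp: g_def)
  have bij_idx: "bij_betw (\<lambda>i. zs ! (i - 1)) {1..n} (set zs)"
    if "distinct zs" "length zs = n" for zs :: "'a list"
  proof -
    have "bij_betw (\<lambda>i. i - 1) {1..n} {..<n}"
      by (rule bij_betw_byWitness[where f' = Suc]) auto
    moreover have "bij_betw ((!) zs) {..<n} (set zs)"
      using bij_betw_nth[OF that(1)] that(2) by simp
    ultimately show ?thesis using bij_betw_trans by (fastforce simp: comp_def)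
  qed
  have bX: "bij_betw g (Gnn_X n) X"
  proof -
    have "bij_betw (g \<circ> Inl) {1..n} X" using bij_idx[OF xs(2) l(1)] xs(1) by (simp add: g_def comp_def)
    then show ?thesis unfolding Gnn_X_def
      by (metis bij_betw_comp_iff inj_Inl inj_on_imp_bij_betw inj_on_subset subset_UNIV)
  qed
  have bY: "bij_betw g (Gnn_Y n) Y"
  proof -
    have "bij_betw (g \<circ> Inr) {1..n} Y" using bij_idx[OF ys(2) l(2)] ys(1) by (simp add: g_def comp_def)
    then show ?thesis unfolding Gnn_Y_def
      by (metis bij_betw_comp_iff inj_Inr inj_on_imp_bij_betw inj_on_subset subset_UNIV)
  qed
  have "bij_betw g (Gnn_X n \<union> Gnn_Y n) (X \<union> Y)"
    using bX bY dis by (rule bij_betw_combine)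
  moreover have same: "{u, w} \<notin> E" if "u \<in> X \<and> w \<in> X \<or> u \<in> Y \<and> w \<in> Y" for u w
  proof
    assume "{u, w} \<in> E"
    then obtain x y where "x \<in> X" "y \<in> Y" "{u, w} = {x, y}" using bip by blast
    then show False using that dis by (auto simp: doubleton_eq_iff)
  qed
  have cross: "{Inl i, Inr j} \<in> Gnn_E n \<longleftrightarrow> {g (Inl i), g (Inr j)} \<in> E"
    if ij: "i \<in> {1..n}" "j \<in> {1..n}" for i j
  proof -
    have idx: "xs ! (i - 1) = xs ! k \<longleftrightarrow> i = k + 1" if "k < n" for k
      using nth_eq_iff_index_eq[OF xs(2), of "i - 1" k] ij l that by auto
    have x4: "xs ! 0 = a" "xs ! 1 = b1" "xs ! 2 = b2" "xs ! 3 = b3" by (simp_all add: xs_def)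
    have mem: "{xs ! (i - 1), y} \<in> E \<longleftrightarrow> xs ! (i - 1) \<in> nbr E X y" for y
      using gX[OF ij(1)] by (simp add: nbr_def insert_commute)
    consider "j = 1" | "j = 2" | "j = 3" | "j \<ge> 4" using ij by force
    then have "{xs ! (i - 1), ys ! (j - 1)} \<in> E \<longleftrightarrow> j \<ge> 4 \<or> i = 1 \<or> i = j + 1"
    proof cases
      case 1
      then have "ys ! (j - 1) = v1" by (simp add: ys_def)
      then show ?thesis using 1 mem[of v1] N x4 idx[of 0] idx[of 1] n by auto
    next
      case 2
      then have "ys ! (j - 1) = v2" by (simp add: ys_def)
      then show ?thesis using 2 mem[of v2] N x4 idx[of 0] idx[of 2] n by auto
    next
      case 3
      then have "ys ! (j - 1) = v3" by (simp add: ys_def)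
      then show ?thesis using 3 mem[of v3] N x4 idx[of 0] idx[of 3] n by auto
    next
      case 4
      then have "ys ! (j - 1) = q ! (j - 4)" by (simp add: ys_def nth_append numeral_eq_Suc)
      moreover have "j - 4 < length q" using l ij 4 by (simp add: ys_def)
      ultimately have "ys ! (j - 1) \<in> Y - {v1, v2, v3}" using q by (metis nth_mem)
      then show ?thesis using full gX(2)[OF ij(1)] 4 by simp
    qed
    then show ?thesis using Gnn_E_iff[OF ij] gX(1)[OF ij(1)] gY(1)[OF ij(2)] by simp
  qed
  have "{u, w} \<in> Gnn_E n \<longleftrightarrow> {g u, g w} \<in> E" if "u \<in> Gnn_X n \<union> Gnn_Y n" "w \<in> Gnn_X n \<union> Gnn_Y n" for u w
  proof -
    have cross': "{Inr j, Inl i} \<in> Gnn_E n \<longleftrightarrow> {g (Inr j), g (Inl i)} \<in> E"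
      if "i \<in> {1..n}" "j \<in> {1..n}" for i j using cross[OF that] by (simp add: insert_commute)
    have ss: "{g (Inl i), g (Inl j)} \<notin> E" "{g (Inr i), g (Inr j)} \<notin> E"
      if "i \<in> {1..n}" "j \<in> {1..n}" for i j
      using that gX[of i] gX[of j] gY[of i] gY[of j] same by simp_all
    show ?thesis using that cross cross' ss unfolding Gnn_X_def Gnn_Y_def
      by (auto simp: Gnn_E_same_side)
  qed
  ultimately show "graph_iso (Gnn_X n \<union> Gnn_Y n) (Gnn_E n) (X \<union> Y) E"
    unfolding graph_iso_def by blast
qed

section \<open>Closed bipartite graphs with few non-edges\<close>

text \<open>These are the properties retained by an edge-maximal graph without a Hamilton cycle. The
  bound \<open>3 * n\<close> is \<open>n * n - n * (n - 3)\<close>, and sets of size at most 3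
  suffice for the Hall conditions because at most three vertices turn out to have low degree. The
  assumptions are symmetric in the sides, so \<open>swap\<close> transfers every one-sided
  result.\<close>

locale closed_dense_bipartite =
  fixes X Y :: "'a set" and E :: "'a set set" and n :: nat
  assumes disjoint: "X \<inter> Y = {}" and cardX: "card X = n" and cardY: "card Y = n" and n: "n \<ge> 16"
    and closed: "\<And>x y. x \<in> X \<Longrightarrow> y \<in> Y \<Longrightarrow> {x, y} \<notin> E \<Longrightarrow> card (nbr E Y x) + card (nbr E X y) \<le> n"
    and bip: "\<And>e. e \<in> E \<Longrightarrow> \<exists>x\<in>X. \<exists>y\<in>Y. e = {x, y}"
    and dense: "card {(x, y) \<in> X \<times> Y. {x, y} \<notin> E} < 3 * n"
    and hallX: "\<And>T. T \<subseteq> X \<Longrightarrow> T \<noteq> {} \<Longrightarrow> card T \<le> 3 \<Longrightarrow> card T < card (\<Union>x\<in>T. nbr E Y x)"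
    and hallY: "\<And>T. T \<subseteq> Y \<Longrightarrow> T \<noteq> {} \<Longrightarrow> card T \<le> 3 \<Longrightarrow> card T < card (\<Union>y\<in>T. nbr E X y)"
begin

lemma fin: "finite X" "finite Y"
  using cardX cardY n by (auto intro: card_ge_0_finite)

lemma swap: "closed_dense_bipartite Y X E n"
proof
  have "{(y, x) \<in> Y \<times> X. {y, x} \<notin> E} = prod.swap ` {(x, y) \<in> X \<times> Y. {x, y} \<notin> E}"
    by (auto simp: insert_commute image_iff)
  then have "card {(y, x) \<in> Y \<times> X. {y, x} \<notin> E} = card {(x, y) \<in> X \<times> Y. {x, y} \<notin> E}"
    by (simp add: card_image)
  then show "card {(y, x) \<in> Y \<times> X. {y, x} \<notin> E} < 3 * n" using dense by simp
  show "card (nbr E X y) + card (nbr E Y x) \<le> n" if "y \<in> Y" "x \<in> X" "{y, x} \<notin> E" for x y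
    using closed[of x y] that by (simp add: insert_commute add.commute)
  show "\<exists>y\<in>Y. \<exists>x\<in>X. e = {y, x}" if "e \<in> E" for e
    using bip[OF that] by (metis insert_commute)
qed (use disjoint cardX cardY n hallX hallY in auto)

lemma finite_nonedges: "finite {(x, y) \<in> X \<times> Y. {x, y} \<notin> E}"
  by (rule finite_subset[of _ "X \<times> Y"]) (use fin in auto)

lemma card_non_nbr: "card (Y - nbr E Y x) = n - card (nbr E Y x)"
  "card (X - nbr E X y) = n - card (nbr E X y)"
  using fin nbr_subset[of E Y x] nbr_subset[of E X y]
  by (simp_all add: card_Diff_subset finite_subset cardX cardY)

text \<open>Let \<open>d\<close> be the degree of \<open>y\<close>. By closedness each of its
  \<open>n - d\<close> non-neighbours misses at least \<open>d\<close> vertices, giving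
  \<open>d * (n - d)\<close> non-edges. For \<open>4 \<le> d \<le> n - 4\<close> this is at least
  \<open>4 * (n - 4)\<close>, which reaches \<open>3 * n\<close> exactly when
  \<open>n \<ge> 16\<close>.\<close>

lemma degree_gap:
  assumes y: "y \<in> Y"
  shows "card (nbr E X y) \<le> 3 \<or> n \<le> card (nbr E X y) + 3"
proof (rule ccontr)
  assume "\<not> ?thesis"
  then have d: "card (nbr E X y) \<ge> 4" "n \<ge> card (nbr E X y) + 4" by auto
  let ?d = "card (nbr E X y)" and ?W = "X - nbr E X y"
  have "?d \<le> card (Y - nbr E Y x)" if "x \<in> ?W" for x
    using closed[of x y] that y card_non_nbr(1)[of x] by (auto simp: nbr_def insert_commute)
  then have "(\<Sum>x\<in>?W. ?d) \<le> (\<Sum>x\<in>?W. card (Y - nbr E Y x))" by (rule sum_mono)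
  also have "\<dots> = card (Sigma ?W (\<lambda>x. Y - nbr E Y x))" using fin by simp
  also have "\<dots> \<le> card {(x, y) \<in> X \<times> Y. {x, y} \<notin> E}"
    by (intro card_mono finite_nonedges) (auto simp: nbr_def)
  finally have "(n - ?d) * ?d < 3 * n" using dense card_non_nbr(2)[of y] by simp
  \<comment> \<open>Writing the degree and \<open>n\<close> through \<open>a\<close> and
    \<open>b\<close> removes natural-number subtraction; \<open>n \<ge> 16\<close> becomes
    \<open>a + b \<ge> 8\<close>.\<close>
  moreover obtain a where a: "?d = 4 + a" using d(1) le_Suc_ex by blast
  moreover obtain b where b: "n = ?d + 4 + b" using d(2) le_Suc_ex by blast
  ultimately have "(4 + b) * (4 + a) < 3 * (8 + a + b)" by simp
  then show False using a b n by (simp add: algebra_simps)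
qed

section \<open>Vertices of low degree\<close>

definition "LX = {x \<in> X. card (nbr E Y x) \<le> 3}"
definition "LY = {y \<in> Y. card (nbr E X y) \<le> 3}"

lemma low_subset: "LX \<subseteq> X" "LY \<subseteq> Y" "finite LX" "finite LY"
  using fin by (auto simp: LX_def LY_def)

text \<open>By \<open>degree_gap\<close> both degrees are at least \<open>n - 3\<close>, so their
  sum exceeds \<open>n\<close> and closedness forbids a non-edge.\<close>

lemma high_adjacent:
  assumes "x \<in> X - LX" "y \<in> Y - LY"
  shows "{x, y} \<in> E"
proof (rule ccontr)
  assume "{x, y} \<notin> E"
  then have "card (nbr E Y x) + card (nbr E X y) \<le> n" using closed assms by auto
  moreover have "n \<le> card (nbr E X y) + 3" using degree_gap[of y] assms by (auto simp: LY_def)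
  moreover have "n \<le> card (nbr E Y x) + 3"
    using closed_dense_bipartite.degree_gap[OF swap, of x] assms by (auto simp: LX_def)
  ultimately show False using n by simp
qed

text \<open>Each low vertex misses at least \<open>n - 3\<close> vertices. Pairs between
  \<open>A\<close> and \<open>B\<close> are charged to \<open>A\<close> only, hence the subtraction
  of \<open>card A\<close>.\<close>

lemma low_count:
  assumes A: "A \<subseteq> LY" and B: "B \<subseteq> LX"
  shows "card A * (n - 3) + card B * (n - 3 - card A) < 3 * n"
proof -
  have finAB: "finite A" "finite B" using assms low_subset by (auto intro: finite_subset)
  let ?P = "prod.swap ` Sigma A (\<lambda>y. X - nbr E X y)" and ?Q = "Sigma B (\<lambda>x. (Y - nbr E Y x) - A)"
  have "card A * (n - 3) = (\<Sum>y\<in>A. n - 3)" by simp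
  also have "\<dots> \<le> (\<Sum>y\<in>A. card (X - nbr E X y))"
    using A card_non_nbr(2) by (intro sum_mono) (auto simp: LY_def)
  also have "\<dots> = card ?P" using fin finAB by (simp add: card_image)
  finally have P: "card A * (n - 3) \<le> card ?P" .
  have "card B * (n - 3 - card A) = (\<Sum>x\<in>B. n - 3 - card A)" by simp
  also have "\<dots> \<le> (\<Sum>x\<in>B. card ((Y - nbr E Y x) - A))"
  proof (rule sum_mono)
    fix x assume "x \<in> B"
    then have "n - 3 \<le> card (Y - nbr E Y x)" using B card_non_nbr(1)[of x] by (auto simp: LX_def)
    then show "n - 3 - card A \<le> card ((Y - nbr E Y x) - A)"
      using diff_card_le_card_Diff[OF finAB(1), of "Y - nbr E Y x"] by linarith
  qed
  also have "\<dots> = card ?Q" using fin finAB by simp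
  finally have Q: "card B * (n - 3 - card A) \<le> card ?Q" .
  have "card ?P + card ?Q = card (?P \<union> ?Q)"
    using fin finAB by (intro card_Un_disjoint[symmetric]) auto
  also have "\<dots> \<le> card {(x, y) \<in> X \<times> Y. {x, y} \<notin> E}"
    using A B low_subset by (intro card_mono finite_nonedges) (auto simp: nbr_def insert_commute)
  finally show ?thesis using P Q dense by linarith
qed

text \<open>Four low vertices, split 2+2, 3+1 or 4+0, would cause at least \<open>4n - 16\<close>,
  \<open>4n - 15\<close> or \<open>4n - 12\<close> non-edges, never fewer than \<open>3n\<close> for
  \<open>n \<ge> 16\<close>.\<close>

lemma low_total:
  assumes le: "card LX \<le> card LY"
  shows "card LX + card LY \<le> 3"
proof (rule ccontr)
  assume "\<not> ?thesis"
  then have ge: "card LX + card LY \<ge> 4" by simp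
  \<comment> \<open>As many as possible of the four are taken from \<open>LY\<close>; by
    \<open>le\<close> these are at least two.\<close>
  obtain A where A: "A \<subseteq> LY" "card A = min 4 (card LY)"
    using obtain_subset_with_card_n[of "min 4 (card LY)" LY] by auto
  obtain B where B: "B \<subseteq> LX" "card B = 4 - min 4 (card LY)"
  proof -
    have "4 - min 4 (card LY) \<le> card LX" using ge by auto
    then show ?thesis using that obtain_subset_with_card_n by metis
  qed
  have "card A = 2 \<and> card B = 2 \<or> card A = 3 \<and> card B = 1 \<or> card A = 4 \<and> card B = 0"
    using A B ge le by auto
  then show False using low_count[OF A(1) B(1)] n by auto
qed

lemma degree_ge_2: "v \<in> Y \<Longrightarrow> card (nbr E X v) \<ge> 2"
  using hallY[of "{v}"] by simp

text \<open>Closedness at the pair \<open>x, v\<close>, where \<open>x\<close> is adjacent to every vertex of \<open>Y - LY\<close>.\<close>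
lemma low_non_neighbour:
  assumes x: "x \<in> X - LX" and v: "v \<in> LY" and xv: "{x, v} \<notin> E"
  shows "card (LY \<inter> nbr E Y x) + card (nbr E X v) \<le> card LY"
proof -
  have "nbr E Y x = (Y - LY) \<union> (LY \<inter> nbr E Y x)"
    using high_adjacent[OF x] low_subset by (auto simp: nbr_def)
  then have "card (nbr E Y x) = card ((Y - LY) \<union> (LY \<inter> nbr E Y x))" by simp
  also have "\<dots> = card (Y - LY) + card (LY \<inter> nbr E Y x)"
    using fin low_subset by (intro card_Un_disjoint) auto
  also have "card (Y - LY) = n - card LY" using low_subset by (simp add: card_Diff_subset cardY)
  finally have "card (nbr E Y x) = n - card LY + card (LY \<inter> nbr E Y x)" .
  moreover have "card (nbr E Y x) + card (nbr E X v) \<le> n"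
    using closed x v xv low_subset by auto
  moreover have "card LY \<le> n" using card_mono[OF fin(2) low_subset(2)] cardY by simp
  ultimately show ?thesis by linarith
qed

lemma nbr_low: "v \<in> LY \<Longrightarrow> card (nbr E X v) \<le> 3"
  by (simp add: LY_def)

lemma finite_nbr: "finite (nbr E X v)"
  using fin nbr_subset finite_subset by metis

lemma mem_nbr: "x \<in> X \<Longrightarrow> x \<in> nbr E X v \<longleftrightarrow> {x, v} \<in> E"
  by (simp add: nbr_def insert_commute)

lemma card_high: "card LX \<le> 1 \<Longrightarrow> card (X - LX) \<ge> 15"
  using low_subset n by (simp add: card_Diff_subset cardX)

text \<open>By \<open>low_non_neighbour\<close> and degree at least 2, the single low vertex of
  \<open>Y\<close> would be adjacent to every high vertex of \<open>X\<close>, of which there are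
  far more than three.\<close>

lemma not_one_low:
  assumes le: "card LX \<le> 1" shows "card LY \<noteq> 1"
proof
  assume 1: "card LY = 1"
  then obtain v where v: "LY = {v}" by (auto simp: card_1_singleton_iff)
  have "X - LX \<subseteq> nbr E X v"
  proof
    fix x assume x: "x \<in> X - LX"
    show "x \<in> nbr E X v"
      using low_non_neighbour[OF x, of v] degree_ge_2[of v] v 1 low_subset mem_nbr[of x v] x by auto
  qed
  then have "card (X - LX) \<le> card (nbr E X v)" by (intro card_mono finite_nbr)
  then show False using card_high[OF le] nbr_low[of v] v by simp
qed

text \<open>High vertices of \<open>X\<close> see both low vertices or neither, and some see
  neither, so both low degrees are 2. The Hall condition needs three neighbours in total; as
  \<open>LX\<close> holds at most one, two are common high ones, and then the neighbourhoods
  coincide, a contradiction.\<close>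

lemma not_two_low:
  assumes le: "card LX \<le> 1" shows "card LY \<noteq> 2"
proof
  assume 2: "card LY = 2"
  then obtain v w where vw: "LY = {v, w}" "v \<noteq> w" by (auto simp: card_2_iff)
  have vwY: "v \<in> Y" "w \<in> Y" "v \<in> LY" "w \<in> LY" using vw low_subset by auto
  \<comment> \<open>The bound 2 of \<open>low_non_neighbour\<close> is already exhausted by the
    degree of \<open>u\<close>.\<close>
  have k: "card (nbr E X u) = 2 \<and> LY \<inter> nbr E Y x = {}"
    if "x \<in> X - LX" "u \<in> LY" "x \<notin> nbr E X u" for x u
  proof -
    have "card (LY \<inter> nbr E Y x) + card (nbr E X u) \<le> 2" using low_non_neighbour[of x u] that 2 mem_nbr by auto
    moreover have "card (nbr E X u) \<ge> 2" using degree_ge_2[of u] that low_subset by auto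
    ultimately have "card (nbr E X u) = 2" "card (LY \<inter> nbr E Y x) = 0" by linarith+
    then show ?thesis using low_subset by simp
  qed
  have same: "x \<in> nbr E X v \<longleftrightarrow> x \<in> nbr E X w" if "x \<in> X - LX" for x
    using k[OF that, of v] k[OF that, of w] vw vwY that by (auto simp: nbr_def insert_commute)
  have "\<not> X - LX \<subseteq> nbr E X v"
    using card_mono[OF finite_nbr, of "X - LX" v] card_high[OF le] nbr_low[of v] vw by auto
  then obtain x where x: "x \<in> X - LX" "x \<notin> nbr E X v" by auto
  then have d: "card (nbr E X v) = 2" "card (nbr E X w) = 2"
    using k[OF x(1), of v] k[OF x(1), of w] same vwY by auto
  let ?A = "nbr E X v - LX"
  have "card {v, w} < card (\<Union>y\<in>{v, w}. nbr E X y)" using vw vwY by (intro hallY) auto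
  then have u: "card (nbr E X v \<union> nbr E X w) \<ge> 3" using vw by simp
  have "nbr E X v \<union> nbr E X w \<subseteq> ?A \<union> LX" using same by (auto dest: nbrD)
  then have "card (nbr E X v \<union> nbr E X w) \<le> card (?A \<union> LX)"
    using finite_nbr low_subset by (intro card_mono) auto
  also have "\<dots> \<le> card ?A + card LX" by (rule card_Un_le)
  finally have A: "card ?A \<ge> 2" using u le by simp
  have "?A = nbr E X v" using A d finite_nbr by (intro card_seteq) auto
  moreover have "?A \<subseteq> nbr E X w" using same by (auto dest: nbrD)
  then have "?A = nbr E X w" using A d finite_nbr by (intro card_seteq) auto
  ultimately show False using u d by simp
qed

text \<open>Everything follows from \<open>F\<close>, which says that a vertex separating two low
  vertices sees just one of the three, combined with the Hall condition for pairs and for the whole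
  triple.\<close>

lemma three_low:
  assumes LX: "LX = {}" and 3: "card LY = 3"
  obtains v1 v2 v3 where "LY = {v1, v2, v3}" "distinct [v1, v2, v3]"
    "\<And>v. v \<in> LY \<Longrightarrow> card (nbr E X v) = 2"
    "\<And>v w. v \<in> LY \<Longrightarrow> w \<in> LY \<Longrightarrow> v \<noteq> w \<Longrightarrow> nbr E X v \<noteq> nbr E X w"
    "\<And>u v w x. u \<in> LY \<Longrightarrow> v \<in> LY \<Longrightarrow> w \<in> LY \<Longrightarrow> v \<noteq> w \<Longrightarrow>
       x \<in> nbr E X v \<Longrightarrow> x \<in> nbr E X w \<Longrightarrow> x \<in> nbr E X u"
proof -
  obtain v1 v2 v3 where v: "LY = {v1, v2, v3}" "distinct [v1, v2, v3]"
    using 3 by (auto simp: card_3_iff)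
  let ?N = "nbr E X"
  \<comment> \<open>The bound 3 of \<open>low_non_neighbour\<close> must accommodate the degree of
    \<open>w\<close>, at least 2, and the low neighbour \<open>v\<close>, so both contributions are
    tight.\<close>
  have F: "card (?N w) = 2 \<and> LY \<inter> nbr E Y x = {v}"
    if "v \<in> LY" "w \<in> LY" "x \<in> ?N v" "x \<notin> ?N w" for v w x
  proof -
    have x: "x \<in> X" using that(3) by (rule nbrD)
    have "card (LY \<inter> nbr E Y x) + card (?N w) \<le> 3" using low_non_neighbour[of x w] that x LX 3 mem_nbr by auto
    moreover have in_v: "v \<in> LY \<inter> nbr E Y x" using that low_subset by (auto simp: nbr_def insert_commute)
    moreover have "card (LY \<inter> nbr E Y x) \<ge> 1"
      using in_v low_subset(4) by (metis One_nat_def Suc_leI card_gt_0_iff empty_iff finite_Int)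
    moreover have "card (?N w) \<ge> 2" using degree_ge_2[of w] that low_subset by auto
    ultimately have "card (?N w) = 2" "card (LY \<inter> nbr E Y x) = 1" by linarith+
    then show ?thesis using in_v by (metis card_1_singletonE singletonD)
  qed
  have hall2: "card (?N v \<union> ?N w) \<ge> 3" if "v \<in> LY" "w \<in> LY" "v \<noteq> w" for v w
  proof -
    have "card {v, w} < card (\<Union>y\<in>{v, w}. ?N y)" using that low_subset by (intro hallY) auto
    then show ?thesis using that by simp
  qed
  \<comment> \<open>Otherwise the three neighbourhoods coincide in a set of at most three vertices,
    against the Hall condition for \<open>LY\<close>.\<close>
  have "\<exists>v w x. v \<in> LY \<and> w \<in> LY \<and> x \<in> ?N v \<and> x \<notin> ?N w"
  proof (rule ccontr)
    assume "\<not> ?thesis"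
    then have "?N v = ?N v1" if "v \<in> LY" for v using v that by blast
    then have "(\<Union>v\<in>LY. ?N v) = (\<Union>v\<in>LY. ?N v1)" by (intro SUP_cong) auto
    also have "\<dots> = ?N v1" using v by simp
    finally have "(\<Union>v\<in>LY. ?N v) = ?N v1" .
    moreover have "card LY < card (\<Union>v\<in>LY. ?N v)" using low_subset v 3 by (intro hallY) auto
    ultimately show False using 3 nbr_low[of v1] v by simp
  qed
  then obtain v w x where x: "v \<in> LY" "w \<in> LY" "x \<in> ?N v" "x \<notin> ?N w" by blast
  then have "v \<noteq> w" by blast
  then have "\<exists>u\<in>LY. u \<noteq> v \<and> u \<noteq> w \<and> LY = {u, v, w}" using v x(1,2) by auto
  then obtain u where u: "u \<in> LY" "u \<noteq> v" "u \<noteq> w" "LY = {u, v, w}" by blast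
  have inY: "w' \<in> nbr E Y x' \<longleftrightarrow> x' \<in> ?N w'" if "x' \<in> X" "w' \<in> LY" for x' w'
    using that low_subset by (auto simp: nbr_def insert_commute)
  have xX: "x \<in> X" using x(3) by (rule nbrD)
  have "LY \<inter> nbr E Y x = {v}" using F[OF x] by simp
  then have "u \<notin> nbr E Y x" using u by auto
  then have "x \<notin> ?N u" using inY xX u by blast
  then have du: "card (?N u) = 2" using F x u by blast
  have dw: "card (?N w) = 2" using F x by blast
  \<comment> \<open>A second separating vertex, seeing only \<open>w\<close>, is needed to apply
    \<open>F\<close> to \<open>v\<close> itself.\<close>
  have "\<exists>x'. x' \<in> ?N w \<and> x' \<notin> ?N u"
  proof (rule ccontr)
    assume "\<not> ?thesis"
    then have "?N w \<union> ?N u = ?N u" by blast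
    then show False using hall2[of w u] u x du by simp
  qed
  then obtain x' where x': "x' \<in> ?N w" "x' \<notin> ?N u" by blast
  then have "LY \<inter> nbr E Y x' = {w}" using F[of w u x'] u x by blast
  moreover have "x' \<in> X" using x'(1) by (rule nbrD)
  ultimately have "x' \<notin> ?N v" using inY \<open>v \<noteq> w\<close> x(1) by blast
  then have dv: "card (?N v) = 2" using F x x' by blast
  show ?thesis
  proof (rule that[OF v])
    show d2: "card (?N v') = 2" if "v' \<in> LY" for v' using that u du dv dw by auto
    show "?N v' \<noteq> ?N w'" if "v' \<in> LY" "w' \<in> LY" "v' \<noteq> w'" for v' w'
      using hall2[OF that] d2[OF that(1)] by auto
    show "y \<in> ?N u'" if "u' \<in> LY" "v' \<in> LY" "w' \<in> LY" "v' \<noteq> w'" "y \<in> ?N v'" "y \<in> ?N w'" for u' v' w' y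
    proof (rule ccontr)
      assume "y \<notin> ?N u'"
      then have "LY \<inter> nbr E Y y = {v'}" "LY \<inter> nbr E Y y = {w'}" using F that by blast+
      then show False using that by auto
    qed
  qed
qed

text \<open>The counts leave no low vertex, where the graph is complete bipartite, or exactly three,
  all in \<open>Y\<close>.\<close>

lemma alt_cycle_or_extremal:
  assumes le: "card LX \<le> card LY"
  shows "alt_cycle X Y E n \<or> graph_iso (X \<union> Y) E (Gnn_X n \<union> Gnn_Y n) (Gnn_E n)"
proof -
  have "card LY \<noteq> 1" "card LY \<noteq> 2" "card LX + card LY \<le> 3"
    using low_total[OF le] not_one_low not_two_low le by linarith+
  then consider "card LY = 0" | "card LY = 3" "card LX = 0" by linarith
  then show ?thesis
  proof cases
    case 1
    then have "LX = {}" "LY = {}" using le low_subset by auto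
    then have "{x, y} \<in> E" if "x \<in> X" "y \<in> Y" for x y using high_adjacent that by simp
    then show ?thesis using complete_alt_cycle cardX cardY n by (metis less_le_trans zero_less_numeral)
  next
    case 2
    then have LX: "LX = {}" using low_subset by simp
    obtain v1 v2 v3 where v: "LY = {v1, v2, v3}" "distinct [v1, v2, v3]"
      and d2: "\<And>v. v \<in> LY \<Longrightarrow> card (nbr E X v) = 2"
      and ne: "\<And>v w. v \<in> LY \<Longrightarrow> w \<in> LY \<Longrightarrow> v \<noteq> w \<Longrightarrow> nbr E X v \<noteq> nbr E X w"
      and common: "\<And>u v w x. u \<in> LY \<Longrightarrow> v \<in> LY \<Longrightarrow> w \<in> LY \<Longrightarrow> v \<noteq> w \<Longrightarrow>
       x \<in> nbr E X v \<Longrightarrow> x \<in> nbr E X w \<Longrightarrow> x \<in> nbr E X u"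
      by (rule three_low[OF LX 2(1)], rule that)
    have full: "{x, y} \<in> E" if "x \<in> X" "y \<in> Y - {v1, v2, v3}" for x y
      using high_adjacent LX v that by simp
    have vL: "v1 \<in> LY" "v2 \<in> LY" "v3 \<in> LY" using v by auto
    have vY: "{v1, v2, v3} \<subseteq> Y" using v low_subset by auto
    \<comment> \<open>By \<open>common\<close>, a vertex shared by two neighbourhoods lies in all
      three, and distinct 2-sets then have distinct second elements: the extremal graph. Otherwise
      the neighbourhoods are disjoint.\<close>
    show ?thesis
    proof (cases "\<exists>v\<in>LY. \<exists>w\<in>LY. v \<noteq> w \<and> nbr E X v \<inter> nbr E X w \<noteq> {}")
      case True
      then obtain a where a: "\<And>u. u \<in> LY \<Longrightarrow> a \<in> nbr E X u" using common by blast
      have ex: "\<exists>b. nbr E X u = {a, b} \<and> b \<noteq> a" if u: "u \<in> LY" for u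
      proof -
        obtain p q where "nbr E X u = {p, q}" "p \<noteq> q" using d2[OF u] by (auto simp: card_2_iff)
        then show ?thesis using a[OF u] by auto
      qed
      obtain b1 b2 b3 where b: "nbr E X v1 = {a, b1}" "b1 \<noteq> a" "nbr E X v2 = {a, b2}" "b2 \<noteq> a"
        "nbr E X v3 = {a, b3}" "b3 \<noteq> a"
        using ex[OF vL(1)] ex[OF vL(2)] ex[OF vL(3)] by blast
      have "b1 \<noteq> b2" using ne[OF vL(1,2)] b(1,3) v(2) by auto
      moreover have "b1 \<noteq> b3" using ne[OF vL(1,3)] b(1,5) v(2) by auto
      moreover have "b2 \<noteq> b3" using ne[OF vL(2,3)] b(3,5) v(2) by auto
      ultimately have "distinct [a, b1, b2, b3]" using b(2,4,6) by simp
      then show ?thesis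
        using extremal_graph_iso[OF disjoint cardX cardY _ bip v(2) vY _ b(1,3,5) full] n by simp
    next
      case False
      obtain a0 a1 where a01: "nbr E X v1 = {a0, a1}" "a0 \<noteq> a1" using d2[OF vL(1)] by (auto simp: card_2_iff)
      obtain a2 a3 where a23: "nbr E X v2 = {a2, a3}" "a2 \<noteq> a3" using d2[OF vL(2)] by (auto simp: card_2_iff)
      obtain a4 a5 where a45: "nbr E X v3 = {a4, a5}" "a4 \<noteq> a5" using d2[OF vL(3)] by (auto simp: card_2_iff)
      have "nbr E X v1 \<inter> nbr E X v2 = {}" "nbr E X v1 \<inter> nbr E X v3 = {}" "nbr E X v2 \<inter> nbr E X v3 = {}"
        using False vL v(2) by auto
      then have "distinct [a0, a1, a2, a3, a4, a5]" using a01 a23 a45 by auto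
      then have "alt_cycle X Y E n"
        using three_disjoint_alt_cycle[OF cardX cardY _ disjoint v(2) vY full _ a01(1) a23(1) a45(1)] n by simp
      then show ?thesis ..
    qed
  qed
qed

end

section \<open>Toughness\<close>

lemma one_tough_swap: "bip_one_tough X Y E \<Longrightarrow> bip_one_tough Y X E"
  unfolding bip_one_tough_def by (simp add: Un_commute disj_commute)

text \<open>Deleting the neighbourhood of \<open>T\<close> isolates every vertex of
  \<open>T\<close>, and a surviving \<open>x0\<close> of \<open>X\<close> lies in a further
  component, so toughness demands at least \<open>card T + 1\<close> deleted vertices.\<close>

lemma one_tough_hall:
  assumes tough: "bip_one_tough X Y E" and dis: "X \<inter> Y = {}" and fin: "finite X" "finite Y"
    and bip: "\<And>e. e \<in> E \<Longrightarrow> \<exists>x\<in>X. \<exists>y\<in>Y. e = {x, y}"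
    and T: "T \<subseteq> Y" "T \<noteq> {}" "card T < card X"
  shows "card T < card (\<Union>y\<in>T. nbr E X y)"
proof (cases "(\<Union>y\<in>T. nbr E X y) = X")
  case True
  then show ?thesis using T by simp
next
  case False
  let ?S = "\<Union>y\<in>T. nbr E X y"
  let ?W = "(X \<union> Y) - ?S"
  let ?cl = "\<lambda>v. {u \<in> ?W. reach ?W E v u}"
  have S: "?S \<subset> X" using False nbr_subset by (metis UN_least psubsetI)
  then obtain x0 where x0: "x0 \<in> X" "x0 \<notin> ?S" by blast
  have TW: "T \<subseteq> ?W" using T S dis by blast
  have cl: "?cl y = {y}" if "y \<in> T" for y
  proof -
    \<comment> \<open>Any first step from \<open>y\<close> would lead to a neighbour of
      \<open>y\<close>, and those are deleted.\<close>
    have "u = y" if "reach ?W E y u" for u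
      using that unfolding reach_def
    proof (cases rule: converse_rtranclpE)
      case (step z)
      then have z: "z \<in> ?W" "{y, z} \<in> E" by auto
      then obtain x y' where "x \<in> X" "y' \<in> Y" "{y, z} = {x, y'}" using bip[OF z(2)] by auto
      then have "z \<in> X" using \<open>y \<in> T\<close> T dis by (auto simp: doubleton_eq_iff)
      then have "z \<in> ?S" using z \<open>y \<in> T\<close> by (auto simp: nbr_def)
      then show ?thesis using z by blast
    qed simp
    moreover have "reach ?W E y y" by (simp add: reach_def)
    ultimately show ?thesis using that TW by auto
  qed
  let ?C = "{C. \<exists>v\<in>?W. C = ?cl v}"
  have "insert (?cl x0) ((\<lambda>y. {y}) ` T) \<subseteq> ?C"
  proof (rule insert_subsetI[OF _ image_subsetI])
    show "?cl x0 \<in> ?C" using x0 by blast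
    show "{y} \<in> ?C" if "y \<in> T" for y using cl[OF that] TW that by blast
  qed
  moreover have "finite ?C" by (rule finite_subset[of _ "Pow ?W"]) (use fin in auto)
  ultimately have "card (insert (?cl x0) ((\<lambda>y. {y}) ` T)) \<le> num_components ?W E"
    unfolding num_components_def by (rule card_mono[rotated])
  moreover
  have "?cl x0 \<notin> (\<lambda>y. {y}) ` T"
  proof
    assume "?cl x0 \<in> (\<lambda>y. {y}) ` T"
    then obtain y where y: "y \<in> T" "?cl x0 = {y}" by (elim imageE)
    have "x0 \<in> ?cl x0" using x0 by (simp add: reach_def)
    then have "x0 = y" unfolding y(2) by simp
    then show False using y(1) x0(1) T(1) dis by blast
  qed
  then have "card (insert (?cl x0) ((\<lambda>y. {y}) ` T)) = card T + 1"
    using fin T finite_subset[of T Y] by (simp add: card_image)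
  ultimately have nc: "num_components ?W E \<ge> card T + 1" by simp
  moreover have "card T > 0" using T fin finite_subset by (metis card_gt_0_iff)
  ultimately have "card ?S \<ge> num_components ?W E"
    using tough S unfolding bip_one_tough_def by auto
  then show ?thesis using nc by simp
qed

text \<open>A disconnected graph violates toughness already at the empty set, a proper subset of the
  non-empty \<open>X\<close>.\<close>

lemma one_tough_connected:
  assumes tough: "bip_one_tough X Y E" and fin: "finite X" "finite Y" and ne: "X \<noteq> {}"
    and uv: "u \<in> X \<union> Y" "v \<in> X \<union> Y"
  shows "reach (X \<union> Y) E u v"
proof -
  let ?W = "X \<union> Y"
  let ?cl = "\<lambda>v. {u \<in> ?W. reach ?W E v u}"
  have "\<not> num_components (?W - {}) E > 1"
    using tough ne unfolding bip_one_tough_def by (metis card.empty not_less_zero order_less_le_trans psubsetI empty_subsetI)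
  then have "num_components ?W E \<le> Suc 0" by simp
  moreover have "finite {C. \<exists>v\<in>?W. C = ?cl v}" by (rule finite_subset[of _ "Pow ?W"]) (use fin in auto)
  ultimately have "?cl u = ?cl v"
    using uv unfolding num_components_def by (subst (asm) card_le_Suc0_iff_eq) auto
  moreover have "v \<in> ?cl v" using uv by (simp add: reach_def)
  ultimately show ?thesis by blast
qed

section \<open>Passing to an edge-maximal supergraph without a Hamilton cycle\<close>

theorem theorem1p3:
  fixes X Y :: "'a set" and E :: "'a set set" and n :: nat
  assumes "n \<ge> 16"
    and "bipartite_graph X Y E"
    and "card X = n" and "card Y = n"
    and "bip_one_tough X Y E"
    and "spectral_radius (X \<union> Y) E \<ge> spectral_radius (Gnn_X n \<union> Gnn_Y n) (Gnn_E n)"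
  shows "hamiltonian (X \<union> Y) E \<or> graph_iso (X \<union> Y) E (Gnn_X n \<union> Gnn_Y n) (Gnn_E n)"
proof (cases "alt_cycle X Y E n")
  case True
  then show ?thesis using alt_cycle_hamiltonian[OF True] assms by (auto simp: bipartite_graph_def)
next
  case nc: False
  note n = assms(1) and card = assms(3,4) and tough = assms(5)
  let ?V = "X \<union> Y" and ?G = "Gnn_X n \<union> Gnn_Y n"
  have dis: "X \<inter> Y = {}" and bip: "\<And>e. e \<in> E \<Longrightarrow> \<exists>x\<in>X. \<exists>y\<in>Y. e = {x, y}"
    using assms(2) by (auto simp: bipartite_graph_def)
  have fin: "finite X" "finite Y" and ne: "X \<noteq> {}" "Y \<noteq> {}" using card n by (auto intro: card_ge_0_finite)
  obtain l z where l: "l > 0" "l\<^sup>2 > real n * (real n - 3)"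
    and z: "\<And>v. v \<in> ?G \<Longrightarrow> z v > 0"
      "\<And>v. v \<in> ?G \<Longrightarrow> (\<Sum>u\<in>?G. adj (Gnn_E n) v u * z u) = l * z v"
    using Gnn_positive_eigenvector[of n] n by auto
  define mu where "mu = spectral_radius ?V E"
  have mu: "mu \<in> adj_eigenvalues ?V E"
    unfolding mu_def using fin ne by (intro spectral_radius_in_eigenvalues) auto
  have "Inl 1 \<in> ?G" using n by (auto simp: Gnn_X_def)
  then have "l \<in> adj_eigenvalues ?G (Gnn_E n)"
    unfolding adj_eigenvalues_def using z by (intro CollectI exI[of _ z]) force
  then have "l \<le> spectral_radius ?G (Gnn_E n)"
    by (intro eigenvalue_le_spectral_radius) (auto simp: Gnn_X_def Gnn_Y_def)
  then have lmu: "l \<le> mu" using assms(6) by (simp add: mu_def)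
  define M where "M F = {(x, y) \<in> X \<times> Y. {x, y} \<notin> F}" for F
  have Mfin: "finite (M F)" for F
    by (rule finite_subset[of _ "X \<times> Y"]) (use fin in \<open>auto simp: M_def\<close>)
  \<comment> \<open>More than \<open>n * (n - 3)\<close> of the \<open>n * n\<close> cross pairs are
    edges, since their number is at least \<open>mu ^ 2\<close> and hence at least
    \<open>l ^ 2\<close>.\<close>
  have ME: "card (M E) < 3 * n"
  proof -
    let ?D = "{(x, y) \<in> X \<times> Y. {x, y} \<in> E}"
    have "l\<^sup>2 \<le> mu\<^sup>2" using lmu l by simp
    also have "\<dots> \<le> real (card ?D)" using bipartite_eigenvalue_sq_le[OF fin dis bip mu] .
    finally have "real n * (real n - 3) < real (card ?D)" using l by linarith
    moreover have "card (?D \<union> M E) = card ?D + card (M E)"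
      by (intro card_Un_disjoint Mfin finite_subset[of ?D "X \<times> Y"]) (use fin in \<open>auto simp: M_def\<close>)
    moreover have "?D \<union> M E = X \<times> Y" by (auto simp: M_def)
    ultimately have "real (card (M E)) < 3 * real n"
      using card by (simp add: card_cartesian_product algebra_simps flip: of_nat_add of_nat_mult)
    then show ?thesis by linarith
  qed
  define K where "K = (\<lambda>(x, y). {x, y}) ` (X \<times> Y)"
  \<comment> \<open>Staying inside the edge set \<open>K\<close> of the complete bipartite graph
    keeps candidates bipartite and the family finite, so a maximal member exists.\<close>
  define \<F> where "\<F> = {F. E \<subseteq> F \<and> F \<subseteq> K \<and> \<not> alt_cycle X Y F n}"
  have "E \<subseteq> K" using bip by (force simp: K_def)
  then have "E \<in> \<F>" using nc by (simp add: \<F>_def)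
  moreover have "finite \<F>"
    by (rule finite_subset[of _ "Pow K"]) (use fin in \<open>auto simp: \<F>_def K_def\<close>)
  ultimately have "\<exists>F\<in>\<F>. \<forall>F'\<in>\<F>. F \<subseteq> F' \<longrightarrow> F = F'" by (intro finite_has_maximal) auto
  then obtain F where F: "F \<in> \<F>" and maxF: "\<And>F'. F' \<in> \<F> \<Longrightarrow> F \<subseteq> F' \<Longrightarrow> F = F'" by auto
  have FE: "E \<subseteq> F" and FK: "F \<subseteq> K" and Fnc: "\<not> alt_cycle X Y F n" using F by (auto simp: \<F>_def)
  have Fbip: "\<exists>x\<in>X. \<exists>y\<in>Y. e = {x, y}" if "e \<in> F" for e
  proof -
    have "e \<in> K" using that FK by blast
    then show ?thesis by (auto simp: K_def)
  qed
  have nbr_mono: "nbr E S v \<subseteq> nbr F S v" for S v using FE by (auto simp: nbr_def)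
  have hall_mono: "card (\<Union>x\<in>T. nbr E S x) \<le> card (\<Union>x\<in>T. nbr F S x)" if "finite S" for T S
  proof (rule card_mono)
    show "finite (\<Union>x\<in>T. nbr F S x)" by (rule finite_subset[OF _ that]) (auto dest: nbrD)
    show "(\<Union>x\<in>T. nbr E S x) \<subseteq> (\<Union>x\<in>T. nbr F S x)" by (intro UN_mono nbr_mono subset_refl)
  qed
  interpret closed_dense_bipartite X Y F n
  proof
    show "X \<inter> Y = {}" "card X = n" "card Y = n" "16 \<le> n" by fact+
    \<comment> \<open>Maximality puts a Hamilton cycle into \<open>F\<close> plus a missing edge;
      with a larger degree sum the closure step would put one into \<open>F\<close>.\<close>
    show "card (nbr F Y x) + card (nbr F X y) \<le> n" if xy: "x \<in> X" "y \<in> Y" "{x, y} \<notin> F" for x y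
    proof (rule ccontr)
      assume "\<not> ?thesis"
      then have d: "n < card (nbr F Y x) + card (nbr F X y)" by simp
      have "insert {x, y} F \<notin> \<F>" using maxF[of "insert {x, y} F"] xy by blast
      moreover have "{x, y} \<in> K" using xy by (auto simp: K_def)
      ultimately have "alt_cycle X Y (insert {x, y} F) n" using FE FK by (auto simp: \<F>_def)
      then show False using bipartite_closure_step[OF _ xy(1,2) dis card _ d] Fnc n by simp
    qed
    show "\<exists>x\<in>X. \<exists>y\<in>Y. e = {x, y}" if "e \<in> F" for e using Fbip[OF that] .
    have "card (M F) \<le> card (M E)" using FE by (intro card_mono Mfin) (auto simp: M_def)
    then show "card {(x, y) \<in> X \<times> Y. {x, y} \<notin> F} < 3 * n" using ME by (simp add: M_def)
    \<comment> \<open>Toughness of the given graph yields the bound for \<open>E\<close>;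
      neighbourhoods only grow in \<open>F\<close>.\<close>
    show "card T < card (\<Union>y\<in>T. nbr F X y)" if "T \<subseteq> Y" "T \<noteq> {}" "card T \<le> 3" for T
      using one_tough_hall[OF tough dis fin bip that(1,2)] that(3) card n hall_mono[OF fin(1), of T]
      by linarith
    have bip': "\<exists>x\<in>Y. \<exists>y\<in>X. e = {x, y}" if "e \<in> E" for e
      using bip[OF that] by (metis insert_commute)
    have dis': "Y \<inter> X = {}" using dis by blast
    show "card T < card (\<Union>x\<in>T. nbr F Y x)" if "T \<subseteq> X" "T \<noteq> {}" "card T \<le> 3" for T
      using one_tough_hall[OF one_tough_swap[OF tough] dis' fin(2,1) bip' that(1,2)]
        that(3) card n hall_mono[OF fin(2), of T]
      by linarith
  qed
  interpret sw: closed_dense_bipartite Y X F n by (rule swap)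
  \<comment> \<open>The side with at least as many low vertices may play the role of
    \<open>Y\<close>.\<close>
  have "card LX \<le> card LY \<or> card sw.LX \<le> card sw.LY"
    unfolding LX_def LY_def sw.LX_def sw.LY_def by linarith
  then have iso: "graph_iso ?V F ?G (Gnn_E n)"
    using alt_cycle_or_extremal sw.alt_cycle_or_extremal Fnc alt_cycle_swap[of Y X F n]
    by (auto simp: Un_commute)
  show ?thesis
  proof (cases "E = F")
    case True
    then show ?thesis using iso by simp
  next
    case False
    then obtain e where "e \<in> F" "e \<notin> E" using FE by blast
    then obtain a b where ab: "a \<in> ?V" "b \<in> ?V" "{a, b} \<in> F" "{a, b} \<notin> E" using Fbip by blast
    obtain f where f: "bij_betw f ?V ?G" "\<And>u v. u \<in> ?V \<Longrightarrow> v \<in> ?V \<Longrightarrow> {u, v} \<in> F \<longleftrightarrow> {f u, f v} \<in> Gnn_E n"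
      using iso unfolding graph_iso_def by blast
    have fV: "f v \<in> ?G" if "v \<in> ?V" for v using f(1) that by (rule bij_betw_apply)
    \<comment> \<open>The positive eigenvector is carried back along the isomorphism; strict
      monotonicity then gives \<open>mu < l\<close>, contradicting \<open>lmu\<close>.\<close>
    have eig: "(\<Sum>u\<in>?V. adj F v u * z (f u)) = l * z (f v)" if v: "v \<in> ?V" for v
    proof -
      have "(\<Sum>u\<in>?V. adj F v u * z (f u)) = (\<Sum>u\<in>?V. adj (Gnn_E n) (f v) (f u) * z (f u))"
        using f(2)[OF v] by (intro sum.cong) (auto simp: adj_def)
      also have "\<dots> = (\<Sum>u\<in>?G. adj (Gnn_E n) (f v) u * z u)"
        by (rule sum.reindex_bij_betw[OF f(1)])
      finally show ?thesis using z(2)[OF fV[OF v]] by simp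
    qed
    have "mu < l"
    proof (rule proper_subgraph_eigenvalue_less[OF _ FE _ eig _ ab mu])
      show "finite ?V" using fin by simp
      show "z (f v) > 0" if "v \<in> ?V" for v using z(1)[OF fV[OF that]] .
      show "reach ?V E u v" if "u \<in> ?V" "v \<in> ?V" for u v
        using one_tough_connected[OF tough fin ne(1) that] .
    qed
    then show ?thesis using lmu by simp
  qed
qed

end
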